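(* Let $(t,u,v,w)\in\mathbb R^4$ be given and let $x\in X$. Then there exists an $\omega\in\Omega_\tau$ such that the operator $H_\omega$ on $\ell^2(\mathbb Z)$ is unitarily equivalent to $M_x(t,u,v,w)$.
   Context: **The subshift.** Let $\mathcal A=\{a,x,y,z\}$ and let $\tau$ be the substitution $a\mapsto axa$, $x\mapsto y$, $y\mapsto z$, $z\mapsto x$, extended to words by concatenation. $\mathrm{Sub}_\tau$ is the set of all finite subwords (blocks of consecutive letters, including the empty word) of the words $\tau^n(s)$, $s\in\mathcal A$, $n\ge 0$. Let $\Omega_\tau=\{\omega\in\mathcal A^{\mathbb Z}: \text{every finite subword of }\omega\text{ belongs to }\mathrm{Sub}_\tau\}$ and $(T\omega)(n)=\omega(n+1)$. In every $\omega\in\Omega_\tau$ every other letter is $a$. **The operators $H_\omega$.** Given $t,u,v,w\in\mathbb R$ put $D:=u+v+w$ and define $f,g:\Omega_\tau\to\mathbb R$ by: $f(\omega)=t$ if $\omega_0=a$, $D-w$ if $\omega_0=x$, $D-v$ if $\omega_0=y$, $D-u$ if $\omega_0=z$; $g(\omega)=w$ if $\omega_{-1}\omega_0\in\{ax,xa\}$, $v$ if $\omega_{-1}\omega_0\in\{ay,ya\}$, $u$ if $\omega_{-1}\omega_0\in\{az,za\}$. For $\omega\in\Omega_\tau$ let $H_\omega$ be the bounded selfadjoint operator on $\ell^2(\mathbb Z)$ with $(H_\omega\varphi)(n)=f(T^{n-1}\omega)\varphi(n-1)+f(T^n\omega)\varphi(n+1)+g(T^n\omega)\varphi(n)$. **The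 group.** $G$ is Grigorchuk's group: the group of automorphisms of the rooted binary tree $\mathcal T$ (vertex set $\{0,1\}^*$) generated by the involutions $a,b,c,d$ given by $a(0w)=1w$, $a(1w)=0w$; $b(0w)=0a(w)$, $b(1w)=1c(w)$; $c(0w)=0a(w)$, $c(1w)=1d(w)$; $d(0w)=0w$, $d(1w)=1b(w)$. It acts by homeomorphisms on the boundary $\partial\mathcal T=\{0,1\}^{\mathbb N}$. **Schreier graphs and $X$.** For $\xi\in\partial\mathcal T$ the graph $\Gamma_\xi$ has vertex set $G\xi$ and, for each $s\in\{a,b,c,d\}$, an undirected edge labeled $s$ between $p$ and $q$ iff $sp=q$ (loops and multiple edges allowed; each vertex is incident to exactly one edge of each label). $\mathcal G_*$ is the space of isomorphism classes $[(\Gamma,v)]$ of rooted connected graphs with edges labeled in $\{a,b,c,d\}$, with the topology of local convergence (two classes are close if large balls around the roots are isomorphic as rooted labeled graphs). Put $\mathcal F(\xi)=[(\Gamma_\xi,\xi)]$ and $X:=\overline{\mathcal F(\partial\mathcal T)}\setminus\{\text{isolated points of }\overline{\mathcal F(\partial\mathcal T)}\}$. **Laplacians.** For a graph $\Gamma$ with vertex set $V$ and edges labeled by $a,b,c,d$, the Laplacian $M_\Gamma(t,u,v,w)$ is the selfadjoint operator on $\ell^2(V)$ given by $(M_\Gamma(t,u,v,w)\varphi)(p)=\sum_{e} w(e)\,\varphi(q_e)$, where the sum is over all edges $e$ emanating from $p$, $q_e$ is the other endpoint of $e$ ($q_e=p$ for a loop, which is counted once), and $w(e)=t,u,v,w$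 according to whether the label of $e$ is $a,b,c,d$. For $x\in X$, $M_x(t,u,v,w)$ denotes $M_{\widehat x}(t,u,v,w)$ for a chosen representative $\widehat x$ of the isomorphism class $x$ (unique up to unitary equivalence). *)

theory Defs
  imports
    "HOL-Analysis.Analysis"
    "HOL-Algebra.Bij"
    "HOL-Algebra.Generated_Groups"
    "HOL-Library.Sublist"
begin

text \<open>A vector of \<open>\<ell>\<^sup>2(V)\<close> is a square-summable complex function, set to \<open>0\<close> outside \<open>V\<close>.\<close>

definition ell2_space :: "'i set \<Rightarrow> ('i \<Rightarrow> complex) set" where
  "ell2_space V = {\<phi>. (\<forall>p. p \<notin> V \<longrightarrow> \<phi> p = 0) \<and> (\<lambda>p. (cmod (\<phi> p))\<^sup>2) summable_on V}"

definition ell2_inner :: "'i set \<Rightarrow> ('i \<Rightarrow> complex) \<Rightarrow> ('i \<Rightarrow> complex) \<Rightarrow> complex" where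
  "ell2_inner V \<phi> \<psi> = (\<Sum>\<^sub>\<infinity>p\<in>V. cnj (\<phi> p) * \<psi> p)"

definition unitary_between ::
  "'i set \<Rightarrow> 'j set \<Rightarrow> (('i \<Rightarrow> complex) \<Rightarrow> ('j \<Rightarrow> complex)) \<Rightarrow> bool" where
  "unitary_between V W U \<longleftrightarrow>
     bij_betw U (ell2_space V) (ell2_space W) \<and>
     (\<forall>\<phi>\<in>ell2_space V. \<forall>\<psi>\<in>ell2_space V. U (\<lambda>p. \<phi> p + \<psi> p) = (\<lambda>q. U \<phi> q + U \<psi> q)) \<and>
     (\<forall>c. \<forall>\<phi>\<in>ell2_space V. U (\<lambda>p. c * \<phi> p) = (\<lambda>q. c * U \<phi> q)) \<and>
     (\<forall>\<phi>\<in>ell2_space V. \<forall>\<psi>\<in>ell2_space V. ell2_inner W (U \<phi>) (U \<psi>) = ell2_inner V \<phi> \<psi>)"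

definition unitarily_equivalent ::
  "'i set \<Rightarrow> (('i \<Rightarrow> complex) \<Rightarrow> ('i \<Rightarrow> complex)) \<Rightarrow>
   'j set \<Rightarrow> (('j \<Rightarrow> complex) \<Rightarrow> ('j \<Rightarrow> complex)) \<Rightarrow> bool" where
  "unitarily_equivalent V A W B \<longleftrightarrow>
     (\<exists>U. unitary_between V W U \<and> (\<forall>\<phi>\<in>ell2_space V. U (A \<phi>) = B (U \<phi>)))"

datatype letter = La | Lx | Ly | Lz

fun tau :: "letter \<Rightarrow> letter list" where
  "tau La = [La, Lx, La]"
| "tau Lx = [Ly]"
| "tau Ly = [Lz]"
| "tau Lz = [Lx]"

definition tau_word :: "letter list \<Rightarrow> letter list" where
  "tau_word us = concat (map tau us)"

definition Sub_tau :: "letter list set" where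
  "Sub_tau = {us. \<exists>s n. sublist us ((tau_word ^^ n) [s])}"

definition Omega_tau :: "(int \<Rightarrow> letter) set" where
  "Omega_tau = {\<omega>. \<forall>i j. map \<omega> [i..j] \<in> Sub_tau}"

text \<open>\<open>shift n\<close> is the power \<open>T\<^sup>n\<close> (\<open>n \<in> \<int>\<close>) of the shift \<open>(T\<omega>)(k) = \<omega>(k+1)\<close>.\<close>

definition shift :: "int \<Rightarrow> (int \<Rightarrow> letter) \<Rightarrow> (int \<Rightarrow> letter)" where
  "shift n \<omega> = (\<lambda>k. \<omega> (k + n))"

definition f_coeff :: "real \<Rightarrow> real \<Rightarrow> real \<Rightarrow> real \<Rightarrow> (int \<Rightarrow> letter) \<Rightarrow> real" where
  "f_coeff t u v w \<omega> =
     (let D = u + v + w in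
      case \<omega> 0 of La \<Rightarrow> t | Lx \<Rightarrow> D - w | Ly \<Rightarrow> D - v | Lz \<Rightarrow> D - u)"

text \<open>The final value \<open>0\<close> is irrelevant: on \<open>Omega_tau\<close> exactly one of \<open>\<omega> (-1)\<close> and \<open>\<omega> 0\<close> is \<open>La\<close>.\<close>

definition g_coeff :: "real \<Rightarrow> real \<Rightarrow> real \<Rightarrow> (int \<Rightarrow> letter) \<Rightarrow> real" where
  "g_coeff u v w \<omega> =
     (if (\<omega> (-1), \<omega> 0) \<in> {(La, Lx), (Lx, La)} then w
      else if (\<omega> (-1), \<omega> 0) \<in> {(La, Ly), (Ly, La)} then v
      else if (\<omega> (-1), \<omega> 0) \<in> {(La, Lz), (Lz, La)} then u
      else 0)"

definition H_op ::
  "real \<Rightarrow> real \<Rightarrow> real \<Rightarrow> real \<Rightarrow> (int \<Rightarrow> letter) \<Rightarrow> (int \<Rightarrow> complex) \<Rightarrow> (int \<Rightarrow> complex)" where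
  "H_op t u v w \<omega> \<phi> = (\<lambda>n.
       of_real (f_coeff t u v w (shift (n - 1) \<omega>)) * \<phi> (n - 1)
     + of_real (f_coeff t u v w (shift n \<omega>)) * \<phi> (n + 1)
     + of_real (g_coeff u v w (shift n \<omega>)) * \<phi> n)"

text \<open>Letters \<open>0\<close>, \<open>1\<close> of the binary tree are encoded as \<open>False\<close>, \<open>True\<close>.\<close>

datatype gen = Ga | Gb | Gc | Gd

fun gen_act :: "gen \<Rightarrow> bool list \<Rightarrow> bool list" where
  "gen_act s [] = []"
| "gen_act Ga (False # w) = True # w"
| "gen_act Ga (True # w) = False # w"
| "gen_act Gb (False # w) = False # gen_act Ga w"
| "gen_act Gb (True # w) = True # gen_act Gc w"
| "gen_act Gc (False # w) = False # gen_act Ga w"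
| "gen_act Gc (True # w) = True # gen_act Gd w"
| "gen_act Gd (False # w) = False # w"
| "gen_act Gd (True # w) = True # gen_act Gb w"

text \<open>The generators are tree automorphisms, so the subgroup they generate inside the group of
  all permutations of \<open>{0,1}\<^sup>*\<close> is the one they generate inside the automorphism group.\<close>

definition grigorchuk :: "(bool list \<Rightarrow> bool list) set" where
  "grigorchuk = generate (BijGroup UNIV) (range gen_act)"

type_synonym boundary = "nat \<Rightarrow> bool"

text \<open>The image of \<open>\<xi>\<close> is the ray whose prefixes are the images of the prefixes of \<open>\<xi>\<close>.\<close>

definition boundary_act :: "(bool list \<Rightarrow> bool list) \<Rightarrow> boundary \<Rightarrow> boundary" where
  "boundary_act h \<xi> = (\<lambda>n. h (map \<xi> [0..<Suc n]) ! n)"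

definition boundary_orbit :: "boundary \<Rightarrow> boundary set" where
  "boundary_orbit \<xi> = (\<lambda>h. boundary_act h \<xi>) ` grigorchuk"

text \<open>Undirected multigraphs with labeled edges: \<open>gends \<Gamma> e\<close> is the set of endpoints of \<open>e\<close>,
  a singleton precisely if \<open>e\<close> is a loop.\<close>

record ('v, 'e) lgraph =
  gverts :: "'v set"
  gedges :: "'e set"
  gends :: "'e \<Rightarrow> 'v set"
  glabel :: "'e \<Rightarrow> gen"

type_synonym ('v, 'e) rooted_lgraph = "('v, 'e) lgraph \<times> 'v"

definition wf_lgraph :: "('v, 'e) lgraph \<Rightarrow> bool" where
  "wf_lgraph \<Gamma> \<longleftrightarrow> (\<forall>e\<in>gedges \<Gamma>. \<exists>p\<in>gverts \<Gamma>. \<exists>q\<in>gverts \<Gamma>. gends \<Gamma> e = {p, q})"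

definition incident_edges :: "('v, 'e) lgraph \<Rightarrow> 'v \<Rightarrow> 'e set" where
  "incident_edges \<Gamma> p = {e \<in> gedges \<Gamma>. p \<in> gends \<Gamma> e}"

definition adjacency :: "('v, 'e) lgraph \<Rightarrow> ('v \<times> 'v) set" where
  "adjacency \<Gamma> = {(p, q). \<exists>e\<in>gedges \<Gamma>. gends \<Gamma> e = {p, q}}"

definition connected_lgraph :: "('v, 'e) lgraph \<Rightarrow> bool" where
  "connected_lgraph \<Gamma> \<longleftrightarrow> (\<forall>p\<in>gverts \<Gamma>. \<forall>q\<in>gverts \<Gamma>. (p, q) \<in> (adjacency \<Gamma>)\<^sup>*)"

definition rooted_connected :: "('v, 'e) rooted_lgraph \<Rightarrow> bool" where
  "rooted_connected R \<longleftrightarrow> (case R of (\<Gamma>, r) \<Rightarrow>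
     wf_lgraph \<Gamma> \<and> r \<in> gverts \<Gamma> \<and> connected_lgraph \<Gamma> \<and>
     (\<forall>p\<in>gverts \<Gamma>. finite (incident_edges \<Gamma> p)))"

definition rooted_iso :: "('v, 'e) rooted_lgraph \<Rightarrow> ('v, 'e) rooted_lgraph \<Rightarrow> bool" where
  "rooted_iso R R' \<longleftrightarrow> (case (R, R') of ((\<Gamma>, r), (\<Gamma>', r')) \<Rightarrow>
     (\<exists>f h. bij_betw f (gverts \<Gamma>) (gverts \<Gamma>') \<and> bij_betw h (gedges \<Gamma>) (gedges \<Gamma>') \<and> f r = r' \<and>
        (\<forall>e\<in>gedges \<Gamma>. gends \<Gamma>' (h e) = f ` gends \<Gamma> e \<and> glabel \<Gamma>' (h e) = glabel \<Gamma> e)))"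

definition rooted_ball :: "nat \<Rightarrow> ('v, 'e) rooted_lgraph \<Rightarrow> ('v, 'e) rooted_lgraph" where
  "rooted_ball n R = (case R of (\<Gamma>, r) \<Rightarrow>
     let B = {q \<in> gverts \<Gamma>. \<exists>k\<le>n. (r, q) \<in> adjacency \<Gamma> ^^ k}
     in (\<Gamma>\<lparr>gverts := B, gedges := {e \<in> gedges \<Gamma>. gends \<Gamma> e \<subseteq> B}\<rparr>, r))"

definition rooted_iso_rel :: "(('v, 'e) rooted_lgraph \<times> ('v, 'e) rooted_lgraph) set" where
  "rooted_iso_rel = {(R, R'). rooted_connected R \<and> rooted_connected R' \<and> rooted_iso R R'}"

text \<open>The space \<open>\<G>\<^sub>*\<close>, for vertices and edges drawn from fixed types. Connected locally finite
  graphs are countable, so any infinite types represent every isomorphism class.\<close>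

definition graph_space :: "('v, 'e) rooted_lgraph set set" where
  "graph_space = {R. rooted_connected R} // rooted_iso_rel"

definition graph_nbhd :: "nat \<Rightarrow> ('v, 'e) rooted_lgraph \<Rightarrow> ('v, 'e) rooted_lgraph set set" where
  "graph_nbhd n R =
     {C \<in> graph_space. \<exists>R'\<in>C. rooted_iso (rooted_ball n R) (rooted_ball n R')}"

definition local_topology :: "('v, 'e) rooted_lgraph set topology" where
  "local_topology = topology_generated_by {graph_nbhd n R |n R. rooted_connected R}"

definition isolated_points_of :: "'a topology \<Rightarrow> 'a set \<Rightarrow> 'a set" where
  "isolated_points_of \<T> S = {x \<in> S. \<exists>N. openin \<T> N \<and> N \<inter> S = {x}}"

text \<open>An edge is the pair of its label and its set of endpoints. As the generators are involutions,
  the \<open>s\<close>-edge from \<open>p\<close> to \<open>s p\<close> and the one from \<open>s p\<close> to \<open>p\<close> are the same edge.\<close>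

type_synonym schreier_edge = "gen \<times> boundary set"

definition schreier_graph :: "boundary \<Rightarrow> (boundary, schreier_edge) lgraph" where
  "schreier_graph \<xi> =
     \<lparr>gverts = boundary_orbit \<xi>,
      gedges = {(s, {p, q}) |s p q.
        p \<in> boundary_orbit \<xi> \<and> q \<in> boundary_orbit \<xi> \<and> boundary_act (gen_act s) p = q},
      gends = snd,
      glabel = fst\<rparr>"

definition schreier_class :: "boundary \<Rightarrow> (boundary, schreier_edge) rooted_lgraph set" where
  "schreier_class \<xi> = rooted_iso_rel `` {(schreier_graph \<xi>, \<xi>)}"

definition schreier_closure :: "(boundary, schreier_edge) rooted_lgraph set set" where
  "schreier_closure = Abstract_Topology.closure_of local_topology (range schreier_class)"

definition X_space :: "(boundary, schreier_edge) rooted_lgraph set set" where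
  "X_space = schreier_closure - isolated_points_of local_topology schreier_closure"

definition edge_weight :: "real \<Rightarrow> real \<Rightarrow> real \<Rightarrow> real \<Rightarrow> gen \<Rightarrow> real" where
  "edge_weight t u v w s = (case s of Ga \<Rightarrow> t | Gb \<Rightarrow> u | Gc \<Rightarrow> v | Gd \<Rightarrow> w)"

definition other_end :: "('v, 'e) lgraph \<Rightarrow> 'v \<Rightarrow> 'e \<Rightarrow> 'v" where
  "other_end \<Gamma> p e = (THE q. gends \<Gamma> e = {p, q})"

definition laplacian ::
  "real \<Rightarrow> real \<Rightarrow> real \<Rightarrow> real \<Rightarrow> ('v, 'e) lgraph \<Rightarrow> ('v \<Rightarrow> complex) \<Rightarrow> ('v \<Rightarrow> complex)" where
  "laplacian t u v w \<Gamma> \<phi> = (\<lambda>p.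
     if p \<in> gverts \<Gamma>
     then \<Sum>e\<in>incident_edges \<Gamma> p. of_real (edge_weight t u v w (glabel \<Gamma> e)) * \<phi> (other_end \<Gamma> p e)
     else 0)"

end

theory Submission
  imports Defs
begin

text \<open>The Schreier graphs are lines (or half-lines) along which \<open>a\<close>-edges alternate with edges
  carrying two of the labels \<open>b, c, d\<close>, the third label giving loops. In Gray code, the position of a
  vertex within the level-\<open>n\<close> segment containing it, the generators move by \<open>\<plusminus>1\<close>, and
  the letter read between positions \<open>q\<close> and \<open>q + 1\<close> is the \<open>q\<close>-th letter of the Toeplitz word
  \<open>lim \<tau>\<^sup>n(a)\<close>.

  All graphs in the closure are deterministic, so a rooted graph is determined by which walks from
  its root coincide, and a ball of radius \<open>n\<close> controls walks of length at most \<open>n\<close>. A vertex with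
  three loops forces the root up to isomorphism, so the graphs containing one are isolated. Every
  other graph in the closure is a two-sided line whose finite windows are windows of the Toeplitz
  word, possibly reversed, and the palindromic images of \<open>\<tau>\<close> make the language closed under
  reversal.\<close>

section \<open>The Toeplitz word\<close>

text \<open>Word and graph agree because both depend on the power of 2 dividing
  \<open>q + 1\<close>. If \<open>q + 1\<close> is an odd multiple of 2^(m+1), the vertices at
  \<open>q\<close> and \<open>q + 1\<close> both begin with \<open>m\<close> ones and a zero, and
  the letter at \<open>q\<close> is \<open>next_letter\<close> applied \<open>m + 1\<close> times to
  \<open>La\<close>. Which of \<open>b\<close>, \<open>c\<close>, \<open>d\<close> fixes these
  vertices depends on \<open>m\<close> with period 3, like the letters \<open>x\<close>,
  \<open>y\<close>, \<open>z\<close>.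

  A limit graph need not be the graph of any boundary point, so it carries no Gray code of its own.
  The line is therefore built inside the limit graph, and each finite part of it is compared with a
  boundary point chosen for that part. Position and orientation may change with the part; membership
  in a language closed under reversal does not, and that is all \<open>Omega_tau\<close> asks
  for.\<close>

fun next_letter :: "letter \<Rightarrow> letter" where
  "next_letter La = Lx"
| "next_letter Lx = Ly"
| "next_letter Ly = Lz"
| "next_letter Lz = Lx"

text \<open>The fixed point of the substitution: its odd places repeat the whole word with
  \<open>x\<close>, \<open>y\<close>, \<open>z\<close> replaced by their images and \<open>a\<close>
  by the middle letter of \<open>tau La\<close>. This is the reason for
  \<open>next_letter La = Lx\<close>.\<close>

function toeplitz :: "nat \<Rightarrow> letter" where
  "toeplitz q = (if even q then La else next_letter (toeplitz (q div 2)))"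
  by auto
termination
  by (relation "Wellfounded.measure id") (auto elim: oddE)

declare toeplitz.simps [simp del]

lemma toeplitz_even [simp]: "even q \<Longrightarrow> toeplitz q = La"
  by (subst toeplitz.simps) simp

lemma toeplitz_odd: "toeplitz (Suc (2 * q)) = next_letter (toeplitz q)"
  by (subst toeplitz.simps) simp

lemma next_letter_neq_La [simp]: "next_letter l \<noteq> La"
  by (cases l) auto

lemma tau_neq_La: "l \<noteq> La \<Longrightarrow> tau l = [next_letter l]"
  by (cases l) auto

lemma tau_word_append [simp]: "tau_word (us @ vs) = tau_word us @ tau_word vs"
  by (simp add: tau_word_def)

text \<open>A prefix of length 2k+1 has k+1 letters \<open>a\<close>, which triple, and k other
  letters, which stay single: 3(k+1) + k = 4k+3.\<close>

lemma tau_word_toeplitz: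
  "tau_word (map toeplitz [0..<Suc (2 * k)]) = map toeplitz [0..<4 * k + 3]"
proof (induction k)
  case 0
  have "toeplitz (Suc 0) = Lx" using toeplitz_odd[of 0] by simp
  then show ?case by (simp add: tau_word_def numeral_3_eq_3)
next
  case (Suc k)
  have *: "toeplitz (4 * k + 3) = next_letter (toeplitz (Suc (2 * k)))"
    using toeplitz_odd[of "Suc (2 * k)"] by (simp add: numeral_3_eq_3)
  have "4 * k + 5 = Suc (2 * (2 * k + 2))" by simp
  then have **: "toeplitz (4 * k + 5) = Lx"
    by (simp only: toeplitz_odd) simp
  have ***: "tau (toeplitz (Suc (2 * k))) = [toeplitz (4 * k + 3)]"
    unfolding * by (rule tau_neq_La) (simp add: toeplitz_odd)
  have "tau_word (map toeplitz [0..<Suc (2 * Suc k)]) =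
      tau_word (map toeplitz [0..<Suc (2 * k)]) @
      tau_word [toeplitz (Suc (2 * k)), toeplitz (2 * k + 2)]"
    by (simp flip: tau_word_append)
  also have "\<dots> = map toeplitz [0..<4 * k + 3] @
      map toeplitz [4 * k + 3, 4 * k + 4, 4 * k + 5, 4 * k + 6]"
    unfolding Suc using *** ** by (simp add: tau_word_def)
  also have "\<dots> = map toeplitz [0..<4 * Suc k + 3]"
  proof -
    have "4 * Suc k + 3 = Suc (Suc (Suc (Suc (4 * k + 3))))" by simp
    moreover have "4 * k + 4 = Suc (4 * k + 3)" "4 * k + 5 = Suc (Suc (4 * k + 3))"
      "4 * k + 6 = Suc (Suc (Suc (4 * k + 3)))" by simp_all
    ultimately show ?thesis by (simp only: upt_Suc) simp
  qed
  finally show ?case .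
qed

lemma tau_power_La:
  "(tau_word ^^ n) [La] = map toeplitz [0..<2 ^ Suc n - 1]"
proof (induction n)
  case (Suc n)
  obtain k where k: "(2::nat) ^ n = Suc k"
    by (metis not0_implies_Suc power_not_zero zero_neq_numeral)
  have "(2::nat) ^ Suc n - 1 = Suc (2 * k)" "(2::nat) ^ Suc (Suc n) - 1 = 4 * k + 3"
    using k by auto
  then show ?case using Suc tau_word_toeplitz[of k] by (simp del: power_Suc)
qed simp

lemma toeplitz_window_in_Sub_tau: "map toeplitz [i..<j] \<in> Sub_tau"
proof (cases "i \<le> j")
  case True
  \<comment> \<open>The iterate of index \<open>j\<close> has length 2^(j+1) - 1, which is long
    enough to contain the window.\<close>
  have "j < 2 ^ j" by (rule less_exp)
  then have j: "j \<le> 2 ^ Suc j - 1" unfolding power_Suc by linarith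
  have "[0..<n] = [0..<i] @ [i..<j] @ [j..<n]" if "j \<le> n" for n
    using True that upt_add_eq_append[of 0 i "j - i"] upt_add_eq_append[of 0 j "n - j"] by simp
  from this[OF j]
  have "sublist (map toeplitz [i..<j]) ((tau_word ^^ j) [La])"
    unfolding tau_power_La sublist_def by (metis map_append)
  then show ?thesis unfolding Sub_tau_def by blast
next
  case False
  then show ?thesis by (auto simp: Sub_tau_def)
qed

lemma rev_tau_word: "rev (tau_word us) = tau_word (rev us)"
proof (induction us)
  case (Cons l us)
  then show ?case by (cases l) (auto simp: tau_word_def)
qed (simp add: tau_word_def)

lemma rev_in_Sub_tau:
  assumes "us \<in> Sub_tau" shows "rev us \<in> Sub_tau"
proof -
  obtain s n where "sublist us ((tau_word ^^ n) [s])" using assms by (auto simp: Sub_tau_def)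
  then have "sublist (rev us) (rev ((tau_word ^^ n) [s]))" by simp
  moreover have "rev ((tau_word ^^ n) [s]) = (tau_word ^^ n) [s]"
    by (induction n) (simp_all add: rev_tau_word)
  ultimately show ?thesis by (auto simp: Sub_tau_def)
qed

section \<open>The boundary action in Gray code\<close>

text \<open>The letter belonging to boundary points that begin with exactly \<open>m\<close> ones;
  it is the Toeplitz letter at 2^(m+1) - 1.\<close>

fun run_letter :: "nat \<Rightarrow> letter" where
  "run_letter 0 = Lx"
| "run_letter (Suc m) = next_letter (run_letter m)"

lemma run_letter_neq_La [simp]: "run_letter m \<noteq> La"
  by (cases m) auto

text \<open>A letter \<open>x\<close>, \<open>y\<close> or \<open>z\<close> stands for a pair of
  parallel edges, named here by the one label of \<open>b\<close>, \<open>c\<close>,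
  \<open>d\<close> that the pair leaves out and that gives loops at both ends. The value at
  \<open>La\<close> keeps the map injective.\<close>

fun loop_gen :: "letter \<Rightarrow> gen" where
  "loop_gen La = Ga"
| "loop_gen Lx = Gd"
| "loop_gen Ly = Gc"
| "loop_gen Lz = Gb"

abbreviation bact :: "gen \<Rightarrow> boundary \<Rightarrow> boundary" where
  "bact s \<equiv> boundary_act (gen_act s)"

abbreviation (input) btl :: "boundary \<Rightarrow> boundary" where
  "btl \<xi> \<equiv> (\<lambda>n. \<xi> (Suc n))"

lemma length_gen_act [simp]: "length (gen_act s w) = length w"
  by (induction s w rule: gen_act.induct) auto

lemma take_gen_act: "take n (gen_act s w) = gen_act s (take n w)"
  by (induction s w arbitrary: n rule: gen_act.induct) (auto simp: take_Cons' )

lemma gen_act_involution [simp]: "gen_act s (gen_act s w) = w"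
  by (induction s w rule: gen_act.induct) auto

lemma bact_Ga: "bact Ga \<xi> = \<xi>(0 := \<not> \<xi> 0)"
proof
  fix n
  show "bact Ga \<xi> n = (\<xi>(0 := \<not> \<xi> 0)) n"
    unfolding boundary_act_def map_upt_Suc
    by (cases "\<xi> 0"; cases n) (simp_all del: upt_Suc)
qed

lemma bact_rec:
  "bact Gb \<xi> = case_nat (\<xi> 0) (if \<xi> 0 then bact Gc (btl \<xi>) else bact Ga (btl \<xi>))"
  "bact Gc \<xi> = case_nat (\<xi> 0) (if \<xi> 0 then bact Gd (btl \<xi>) else bact Ga (btl \<xi>))"
  "bact Gd \<xi> = case_nat (\<xi> 0) (if \<xi> 0 then bact Gb (btl \<xi>) else btl \<xi>)"
proof -
  have nth: "map (btl \<xi>) [0..<Suc k] ! k = \<xi> (Suc k)" for k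
    by (simp del: upt_Suc)
  show "bact Gb \<xi> = case_nat (\<xi> 0) (if \<xi> 0 then bact Gc (btl \<xi>) else bact Ga (btl \<xi>))"
    unfolding boundary_act_def map_upt_Suc[of \<xi>]
    by (rule ext, cases "\<xi> 0") (auto simp del: upt_Suc split: nat.split)
  show "bact Gc \<xi> = case_nat (\<xi> 0) (if \<xi> 0 then bact Gd (btl \<xi>) else bact Ga (btl \<xi>))"
    unfolding boundary_act_def map_upt_Suc[of \<xi>]
    by (rule ext, cases "\<xi> 0") (auto simp del: upt_Suc split: nat.split)
  show "bact Gd \<xi> = case_nat (\<xi> 0) (if \<xi> 0 then bact Gb (btl \<xi>) else btl \<xi>)"
    unfolding boundary_act_def map_upt_Suc[of \<xi>]
    by (rule ext, cases "\<xi> 0") (auto simp del: upt_Suc simp: nth split: nat.split)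
qed

text \<open>Passing a leading one turns \<open>b\<close> into \<open>c\<close>, \<open>c\<close>
  into \<open>d\<close> and \<open>d\<close> into \<open>b\<close>; passing a zero turns
  \<open>b\<close> and \<open>c\<close> into \<open>a\<close> and \<open>d\<close> into the
  identity. So each of the three flips the letter behind the first zero, except the one that meets
  this zero as \<open>d\<close>, and the number of ones before it decides which one that is.\<close>

lemma bact_first_zero:
  assumes "\<forall>i<m. \<xi> i" "\<not> \<xi> m" "s \<noteq> Ga"
  shows "bact s \<xi> = (if s = loop_gen (run_letter m) then \<xi> else \<xi>(Suc m := \<not> \<xi> (Suc m)))"
  using assms
proof (induction m arbitrary: \<xi> s)
  case 0
  then show ?case
    by (cases s) (auto simp: bact_rec bact_Ga fun_eq_iff split: nat.split)
next
  case (Suc m)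
  have IH: "bact s (btl \<xi>) = (if s = loop_gen (run_letter m) then btl \<xi>
      else (btl \<xi>)(Suc m := \<not> \<xi> (Suc (Suc m))))" if "s \<noteq> Ga" for s
    using Suc.IH[of "btl \<xi>" s] Suc.prems that by auto
  have "\<xi> 0" using Suc.prems by auto
  \<comment> \<open>The witness is the generator that \<open>s\<close> becomes behind a leading one;
    the letter of the run advances in step with it.\<close>
  have "\<exists>s'. s' \<noteq> Ga \<and> bact s \<xi> = case_nat True (bact s' (btl \<xi>)) \<and>
      (s = loop_gen (run_letter (Suc m)) \<longleftrightarrow> s' = loop_gen (run_letter m))"
  proof (cases s)
    case Ga
    with Suc.prems show ?thesis by simp
  next
    case Gb
    with \<open>\<xi> 0\<close> show ?thesis using run_letter_neq_La[of m]
      by (intro exI[of _ Gc]) (cases "run_letter m"; simp add: bact_rec(1))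
  next
    case Gc
    with \<open>\<xi> 0\<close> show ?thesis using run_letter_neq_La[of m]
      by (intro exI[of _ Gd]) (cases "run_letter m"; simp add: bact_rec(2))
  next
    case Gd
    with \<open>\<xi> 0\<close> show ?thesis using run_letter_neq_La[of m]
      by (intro exI[of _ Gb]) (cases "run_letter m"; simp add: bact_rec(3))
  qed
  then obtain s' where s': "s' \<noteq> Ga" "bact s \<xi> = case_nat True (bact s' (btl \<xi>))"
      "s = loop_gen (run_letter (Suc m)) \<longleftrightarrow> s' = loop_gen (run_letter m)"
    by blast
  show ?case unfolding s'(2,3) IH[OF s'(1)] using \<open>\<xi> 0\<close>
    by (auto simp: fun_eq_iff split: nat.split)
qed

text \<open>The two vertices \<open>1w\<close>, \<open>0w\<close> refine the vertex \<open>w\<close> of the previous level, in this order if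
  the position of \<open>w\<close> is even and in the opposite order if it is odd.\<close>

primrec gray :: "nat \<Rightarrow> boundary \<Rightarrow> nat" where
  "gray 0 \<xi> = 0"
| "gray (Suc n) \<xi> = 2 * gray n (btl \<xi>) + of_bool (\<xi> 0 \<noteq> even (gray n (btl \<xi>)))"

text \<open>The refinements of a position j are 2j and 2j+1, and flipping the first letter exchanges
  them.\<close>

lemma gray_bact_Ga:
  "int (gray (Suc n) (bact Ga \<xi>)) = gray (Suc n) \<xi> + (if even (gray (Suc n) \<xi>) then 1 else -1)"
  by (auto simp: bact_Ga)

text \<open>For neighbours j and j+1 of the previous level, the refinements that touch are 2j+1 and
  2j+2. They carry the first letter 0 if j is even and 1 if j is odd. The base case is the even one,
  with the tail moved by \<open>a\<close>; each further leading one is the odd one. The edge lands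
  at 2j+1, where the Toeplitz word has the successor of its letter at j. The bound
  \<open>m + 2 \<le> N\<close> places the flipped letter among those that \<open>gray\<close>
  reads.\<close>

lemma gray_flip:
  assumes "\<forall>i<m. \<xi> i" "\<not> \<xi> m" "m + 2 \<le> N"
  defines "q \<equiv> gray N \<xi>" and "q' \<equiv> gray N (\<xi>(Suc m := \<not> \<xi> (Suc m)))"
  shows "odd q \<and> q' = Suc q \<and> toeplitz q = run_letter m \<or>
         even q \<and> q = Suc q' \<and> toeplitz q' = run_letter m"
  using assms(1-3) unfolding q_def q'_def
proof (induction m arbitrary: \<xi> N)
  case 0
  then obtain n where N: "N = Suc (Suc n)" by (metis add_2_eq_Suc add_cancel_left_left le_Suc_ex)
  have tl: "(\<lambda>n. (\<xi>(Suc 0 := \<not> \<xi> (Suc 0))) (Suc n)) = bact Ga (btl \<xi>)"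
    by (auto simp: bact_Ga)
  have "\<not> \<xi> 0" using 0 by simp
  define j where "j = gray (Suc n) (btl \<xi>)"
  define j' where "j' = gray (Suc n) (bact Ga (btl \<xi>))"
  have jj: "int j' = j + (if even j then 1 else -1)"
    unfolding j_def j'_def by (rule gray_bact_Ga)
  have g: "gray N \<xi> = 2 * j + of_bool (even j)"
    "gray N (\<xi>(Suc 0 := \<not> \<xi> (Suc 0))) = 2 * j' + of_bool (even j')"
    using \<open>\<not> \<xi> 0\<close> unfolding N gray.simps(2)[of "Suc n"] tl j_def j'_def by auto
  show ?case
  proof (cases "even j")
    case True
    then have "j' = Suc j" using jj by simp
    then show ?thesis unfolding g using True toeplitz_odd[of j] by simp
  next
    case False
    then have "j = Suc j'" using jj by simp
    then show ?thesis unfolding g using False toeplitz_odd[of j'] by simp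
  qed
next
  case (Suc m)
  then obtain n where N: "N = Suc n" "m + 2 \<le> n" by (cases N) auto
  have tl: "(\<lambda>n. (\<xi>(Suc (Suc m) := \<not> \<xi> (Suc (Suc m)))) (Suc n)) =
      (btl \<xi>)(Suc m := \<not> btl \<xi> (Suc m))"
    by auto
  have "\<xi> 0" using Suc.prems by auto
  define j where "j = gray n (btl \<xi>)"
  define j' where "j' = gray n ((btl \<xi>)(Suc m := \<not> btl \<xi> (Suc m)))"
  have IH: "odd j \<and> j' = Suc j \<and> toeplitz j = run_letter m \<or>
         even j \<and> j = Suc j' \<and> toeplitz j' = run_letter m"
    unfolding j_def j'_def using Suc.prems N by (intro Suc.IH) auto
  have g: "gray N \<xi> = 2 * j + of_bool (odd j)"
    "gray N (\<xi>(Suc (Suc m) := \<not> \<xi> (Suc (Suc m)))) = 2 * j' + of_bool (odd j')"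
    using \<open>\<xi> 0\<close> unfolding N gray.simps tl j_def j'_def by auto
  from IH show ?case unfolding g
  proof (elim disjE conjE)
    assume "odd j" "j' = Suc j" "toeplitz j = run_letter m"
    then show "odd (2 * j + of_bool (odd j)) \<and> 2 * j' + of_bool (odd j') = Suc (2 * j + of_bool (odd j)) \<and>
        toeplitz (2 * j + of_bool (odd j)) = run_letter (Suc m) \<or>
        even (2 * j + of_bool (odd j)) \<and> 2 * j + of_bool (odd j) = Suc (2 * j' + of_bool (odd j')) \<and>
        toeplitz (2 * j' + of_bool (odd j')) = run_letter (Suc m)"
      using toeplitz_odd[of j] by simp
  next
    assume "even j" "j = Suc j'" "toeplitz j' = run_letter m"
    then show "odd (2 * j + of_bool (odd j)) \<and> 2 * j' + of_bool (odd j') = Suc (2 * j + of_bool (odd j)) \<and>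
        toeplitz (2 * j + of_bool (odd j)) = run_letter (Suc m) \<or>
        even (2 * j + of_bool (odd j)) \<and> 2 * j + of_bool (odd j) = Suc (2 * j' + of_bool (odd j')) \<and>
        toeplitz (2 * j' + of_bool (odd j')) = run_letter (Suc m)"
      using toeplitz_odd[of j'] by simp
  qed
qed

section \<open>Deterministic labelled graphs\<close>

definition deterministic_at :: "('v, 'e) lgraph \<Rightarrow> 'v \<Rightarrow> bool" where
  "deterministic_at \<Gamma> p \<longleftrightarrow> (\<forall>s. \<exists>!e. e \<in> gedges \<Gamma> \<and> p \<in> gends \<Gamma> e \<and> glabel \<Gamma> e = s)"

definition deterministic :: "('v, 'e) rooted_lgraph \<Rightarrow> bool" where
  "deterministic R \<longleftrightarrow> (case R of (\<Gamma>, r) \<Rightarrow>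
     rooted_connected R \<and> (\<forall>p\<in>gverts \<Gamma>. deterministic_at \<Gamma> p))"

definition nb :: "('v, 'e) lgraph \<Rightarrow> gen \<Rightarrow> 'v \<Rightarrow> 'v" where
  "nb \<Gamma> s p = (THE q. \<exists>e\<in>gedges \<Gamma>. glabel \<Gamma> e = s \<and> gends \<Gamma> e = {p, q})"

lemma nb_eqI:
  assumes "deterministic_at \<Gamma> p" "e \<in> gedges \<Gamma>" "glabel \<Gamma> e = s" "gends \<Gamma> e = {p, q}"
  shows "nb \<Gamma> s p = q"
  unfolding nb_def
proof (rule the_equality)
  show "\<exists>e\<in>gedges \<Gamma>. glabel \<Gamma> e = s \<and> gends \<Gamma> e = {p, q}" using assms by blast
next
  fix q' assume "\<exists>e\<in>gedges \<Gamma>. glabel \<Gamma> e = s \<and> gends \<Gamma> e = {p, q'}"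
  then obtain e' where e': "e' \<in> gedges \<Gamma>" "glabel \<Gamma> e' = s" "gends \<Gamma> e' = {p, q'}" by blast
  have "e' = e" using assms e' unfolding deterministic_at_def by (metis insertI1)
  then show "q' = q" using e' assms by (auto simp: doubleton_eq_iff)
qed

lemma wf_ends_cases:
  assumes "wf_lgraph \<Gamma>" "e \<in> gedges \<Gamma>" "p \<in> gends \<Gamma> e"
  obtains q where "gends \<Gamma> e = {p, q}" "p \<in> gverts \<Gamma>" "q \<in> gverts \<Gamma>"
  using assms unfolding wf_lgraph_def by (metis doubleton_eq_iff insertE singletonD)

lemma nb_edge:
  assumes "wf_lgraph \<Gamma>" "deterministic_at \<Gamma> p"
  obtains e where "e \<in> gedges \<Gamma>" "glabel \<Gamma> e = s" "gends \<Gamma> e = {p, nb \<Gamma> s p}"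
    "p \<in> gverts \<Gamma>" "nb \<Gamma> s p \<in> gverts \<Gamma>"
proof -
  obtain e where e: "e \<in> gedges \<Gamma>" "p \<in> gends \<Gamma> e" "glabel \<Gamma> e = s"
    using assms(2) unfolding deterministic_at_def by blast
  obtain q where "gends \<Gamma> e = {p, q}" "p \<in> gverts \<Gamma>" "q \<in> gverts \<Gamma>"
    using wf_ends_cases[OF assms(1) e(1,2)] .
  then show thesis using that e nb_eqI[OF assms(2) e(1,3)] by auto
qed

lemma deterministicD:
  assumes "deterministic (\<Gamma>, r)"
  shows "wf_lgraph \<Gamma>" "r \<in> gverts \<Gamma>" "rooted_connected (\<Gamma>, r)"
    "\<And>p. p \<in> gverts \<Gamma> \<Longrightarrow> deterministic_at \<Gamma> p"
  using assms by (auto simp: deterministic_def rooted_connected_def)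

lemma nb_in_gverts: "deterministic (\<Gamma>, r) \<Longrightarrow> p \<in> gverts \<Gamma> \<Longrightarrow> nb \<Gamma> s p \<in> gverts \<Gamma>"
  by (meson deterministicD nb_edge)

lemma nb_involution:
  assumes "deterministic (\<Gamma>, r)" "p \<in> gverts \<Gamma>"
  shows "nb \<Gamma> s (nb \<Gamma> s p) = p"
proof -
  obtain e where e: "e \<in> gedges \<Gamma>" "glabel \<Gamma> e = s" "gends \<Gamma> e = {p, nb \<Gamma> s p}"
    "nb \<Gamma> s p \<in> gverts \<Gamma>"
    using nb_edge[OF deterministicD(1)[OF assms(1)] deterministicD(4)[OF assms]] .
  then show ?thesis using deterministicD(4)[OF assms(1)]
    by (intro nb_eqI[of _ _ e]) auto
qed

lemma walk_in_gverts: "deterministic (\<Gamma>, r) \<Longrightarrow> foldr (nb \<Gamma>) g r \<in> gverts \<Gamma>"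
  by (induction g) (auto simp: nb_in_gverts deterministicD(2))

lemma adjacency_in_gverts: "wf_lgraph \<Gamma> \<Longrightarrow> (p, q) \<in> adjacency \<Gamma> \<Longrightarrow> p \<in> gverts \<Gamma> \<and> q \<in> gverts \<Gamma>"
  by (fastforce simp: adjacency_def wf_lgraph_def doubleton_eq_iff)

text \<open>The labels along a path from the root form the walk. \<open>foldr\<close> applies the
  last letter of a word first, so a further step is put at its front.\<close>

lemma gverts_eq_walks:
  assumes "deterministic (\<Gamma>, r)"
  shows "gverts \<Gamma> = range (\<lambda>g. foldr (nb \<Gamma>) g r)"
proof
  show "gverts \<Gamma> \<subseteq> range (\<lambda>g. foldr (nb \<Gamma>) g r)"
  proof
    fix p assume "p \<in> gverts \<Gamma>"
    then have "(r, p) \<in> (adjacency \<Gamma>)\<^sup>*"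
      using assms by (auto simp: deterministic_def rooted_connected_def connected_lgraph_def)
    then show "p \<in> range (\<lambda>g. foldr (nb \<Gamma>) g r)"
    proof induction
      case base
      show ?case by (rule range_eqI[of _ _ "[]"]) simp
    next
      case (step q p)
      then obtain g e where *: "q = foldr (nb \<Gamma>) g r" "e \<in> gedges \<Gamma>" "gends \<Gamma> e = {q, p}"
        by (auto simp: adjacency_def)
      have "q \<in> gverts \<Gamma>" using * walk_in_gverts[OF assms] by simp
      then have "nb \<Gamma> (glabel \<Gamma> e) q = p"
        using * deterministicD(4)[OF assms] by (intro nb_eqI) auto
      then show ?case by (intro range_eqI[of _ _ "glabel \<Gamma> e # g"]) (simp add: *(1))
    qed
  qed
qed (auto simp: walk_in_gverts[OF assms])

section \<open>Rooted isomorphism as an equivalence relation\<close>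

lemma rooted_isoI:
  assumes "bij_betw f (gverts \<Gamma>) (gverts \<Gamma>')" "bij_betw h (gedges \<Gamma>) (gedges \<Gamma>')" "f r = r'"
    "\<And>e. e \<in> gedges \<Gamma> \<Longrightarrow> gends \<Gamma>' (h e) = f ` gends \<Gamma> e \<and> glabel \<Gamma>' (h e) = glabel \<Gamma> e"
  shows "rooted_iso (\<Gamma>, r) (\<Gamma>', r')"
  unfolding rooted_iso_def prod.case using assms by blast

lemma rooted_iso_refl: "rooted_iso R R"
proof (cases R)
  case (Pair \<Gamma> r)
  show ?thesis unfolding Pair by (rule rooted_isoI[of id _ _ id]) auto
qed

lemma rooted_iso_trans:
  assumes "rooted_iso R R'" "rooted_iso R' R''"
  shows "rooted_iso R R''"
proof -
  obtain \<Gamma> r \<Gamma>' r' \<Gamma>'' r'' where [simp]: "R = (\<Gamma>, r)" "R' = (\<Gamma>', r')" "R'' = (\<Gamma>'', r'')"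
    by (metis surj_pair)
  obtain f h where 1: "bij_betw f (gverts \<Gamma>) (gverts \<Gamma>')" "bij_betw h (gedges \<Gamma>) (gedges \<Gamma>')"
      "f r = r'" "\<forall>e\<in>gedges \<Gamma>. gends \<Gamma>' (h e) = f ` gends \<Gamma> e \<and> glabel \<Gamma>' (h e) = glabel \<Gamma> e"
    using assms(1) by (auto simp: rooted_iso_def)
  obtain f' h' where 2: "bij_betw f' (gverts \<Gamma>') (gverts \<Gamma>'')" "bij_betw h' (gedges \<Gamma>') (gedges \<Gamma>'')"
      "f' r' = r''" "\<forall>e\<in>gedges \<Gamma>'. gends \<Gamma>'' (h' e) = f' ` gends \<Gamma>' e \<and> glabel \<Gamma>'' (h' e) = glabel \<Gamma>' e"
    using assms(2) by (auto simp: rooted_iso_def)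
  have h: "e \<in> gedges \<Gamma> \<Longrightarrow> h e \<in> gedges \<Gamma>'" for e using 1(2) by (auto simp: bij_betw_def)
  have "rooted_iso (\<Gamma>, r) (\<Gamma>'', r'')"
    using 1 2 h by (intro rooted_isoI[of "f' \<circ> f" _ _ "h' \<circ> h"]) (auto intro: bij_betw_trans)
  then show ?thesis by simp
qed

lemma rooted_iso_sym:
  assumes "rooted_iso (\<Gamma>, r) (\<Gamma>', r')" "\<forall>e\<in>gedges \<Gamma>. gends \<Gamma> e \<subseteq> gverts \<Gamma>" "r \<in> gverts \<Gamma>"
  shows "rooted_iso (\<Gamma>', r') (\<Gamma>, r)"
proof -
  obtain f h where 1: "bij_betw f (gverts \<Gamma>) (gverts \<Gamma>')" "bij_betw h (gedges \<Gamma>) (gedges \<Gamma>')"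
      "f r = r'" "\<forall>e\<in>gedges \<Gamma>. gends \<Gamma>' (h e) = f ` gends \<Gamma> e \<and> glabel \<Gamma>' (h e) = glabel \<Gamma> e"
    using assms(1) by (auto simp: rooted_iso_def)
  define f' h' where "f' = the_inv_into (gverts \<Gamma>) f" and "h' = the_inv_into (gedges \<Gamma>) h"
  have "gends \<Gamma> (h' e) = f' ` gends \<Gamma>' e \<and> glabel \<Gamma> (h' e) = glabel \<Gamma>' e" if e: "e \<in> gedges \<Gamma>'" for e
  proof -
    obtain d where d: "d \<in> gedges \<Gamma>" "e = h d" using 1(2) e by (metis bij_betw_imp_surj_on imageE)
    have "h' e = d" unfolding d h'_def using 1(2) d by (simp add: bij_betw_def the_inv_into_f_f)
    moreover have "f' (f p) = p" if "p \<in> gends \<Gamma> d" for p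
      using that assms(2) d 1(1) by (auto simp: f'_def bij_betw_def the_inv_into_f_f subset_iff)
    ultimately show ?thesis using d 1(4) by (auto simp: image_image)
  qed
  moreover have "f' r' = r" using 1 assms(3) by (auto simp: f'_def bij_betw_def the_inv_into_f_f)
  moreover have "bij_betw f' (gverts \<Gamma>') (gverts \<Gamma>)" "bij_betw h' (gedges \<Gamma>') (gedges \<Gamma>)"
    using 1 by (auto simp: f'_def h'_def bij_betw_the_inv_into)
  ultimately show ?thesis by (intro rooted_isoI[of f' _ _ h']) auto
qed

lemma equiv_rooted_iso_rel: "equiv {R. rooted_connected R} rooted_iso_rel" (is "equiv ?A ?r")
proof (rule equivI)
  show "?r \<subseteq> ?A \<times> ?A"
    by (auto simp: rooted_iso_rel_def)
  show "refl_on ?A ?r"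
    by (auto simp: refl_on_def rooted_iso_rel_def rooted_iso_refl)
  show "sym ?r"
  proof (rule symI)
    fix R R'
    assume *: "(R, R') \<in> ?r"
    obtain \<Gamma> r \<Gamma>' r' where [simp]: "R = (\<Gamma>, r)" "R' = (\<Gamma>', r')" by (metis surj_pair)
    have "rooted_iso R' R" using * unfolding rooted_iso_rel_def
      by (auto intro!: rooted_iso_sym simp: rooted_connected_def wf_lgraph_def)
    then show "(R', R) \<in> ?r" using * by (auto simp: rooted_iso_rel_def)
  qed
  show "trans ?r"
    by (rule transI) (auto simp: rooted_iso_rel_def intro: rooted_iso_trans)
qed

text \<open>Recording only coincidences of end points allows different vertex types, and an
  arbitrary action in place of a graph allows comparison with \<open>bact\<close> directly.\<close>

definition same_walks :: "nat \<Rightarrow> (gen \<Rightarrow> 'v \<Rightarrow> 'v) \<Rightarrow> 'v \<Rightarrow> (gen \<Rightarrow> 'w \<Rightarrow> 'w) \<Rightarrow> 'w \<Rightarrow> bool" where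
  "same_walks n act r act' r' \<longleftrightarrow>
     (\<forall>g k. length g \<le> n \<longrightarrow> length k \<le> n \<longrightarrow> (foldr act g r = foldr act k r \<longleftrightarrow> foldr act' g r' = foldr act' k r'))"

text \<open>Every vertex is the end of a walk. Sending it to the end of the same walk in the other
  graph is well defined and injective by the two directions of the coincidence, and an edge is
  determined by its label and one end.\<close>

lemma rooted_iso_if_same_walks:
  assumes R: "deterministic (\<Gamma>, r)" and R': "deterministic (\<Gamma>', r')"
    and same: "\<And>n. same_walks n (nb \<Gamma>) r (nb \<Gamma>') r'"
  shows "rooted_iso (\<Gamma>, r) (\<Gamma>', r')"
proof -
  define w where "w g = foldr (nb \<Gamma>) g r" for g
  define w' where "w' g = foldr (nb \<Gamma>') g r'" for g
  have eq: "w g = w k \<longleftrightarrow> w' g = w' k" for g k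
    using same[of "max (length g) (length k)"] by (simp add: same_walks_def w_def w'_def)
  have V: "gverts \<Gamma> = range w" "gverts \<Gamma>' = range w'"
    using gverts_eq_walks[OF R] gverts_eq_walks[OF R'] by (simp_all add: w_def[abs_def] w'_def[abs_def])
  define f where "f p = w' (SOME g. w g = p)" for p
  have f: "f (w g) = w' g" for g
  proof -
    have "w (SOME k. w k = w g) = w g" by (rule someI) simp
    then show ?thesis by (simp add: f_def eq)
  qed
  have bij: "bij_betw f (gverts \<Gamma>) (gverts \<Gamma>')"
    unfolding bij_betw_def inj_on_def V by (auto simp: f eq image_image)
  have f_nb: "f (nb \<Gamma> s p) = nb \<Gamma>' s (f p)" if p: "p \<in> gverts \<Gamma>" for s p
  proof -
    obtain g where g: "p = w g" using p V by auto
    have "nb \<Gamma> s p = w (s # g)" "nb \<Gamma>' s (f p) = w' (s # g)"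
      unfolding g f by (simp_all add: w_def w'_def)
    then show ?thesis by (simp only: f)
  qed
  define h where "h e = (SOME e'. e' \<in> gedges \<Gamma>' \<and> glabel \<Gamma>' e' = glabel \<Gamma> e \<and> gends \<Gamma>' e' = f ` gends \<Gamma> e)"
    for e
  have h: "h e \<in> gedges \<Gamma>' \<and> glabel \<Gamma>' (h e) = glabel \<Gamma> e \<and> gends \<Gamma>' (h e) = f ` gends \<Gamma> e"
    if e: "e \<in> gedges \<Gamma>" for e
  proof -
    obtain p q where pq: "gends \<Gamma> e = {p, q}" "p \<in> gverts \<Gamma>"
      using deterministicD(1)[OF R] e by (auto simp: wf_lgraph_def)
    have q: "q = nb \<Gamma> (glabel \<Gamma> e) p"
      using nb_eqI[OF deterministicD(4)[OF R pq(2)] e _ pq(1)] by simp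
    have "f p \<in> gverts \<Gamma>'" using bij pq by (auto simp: bij_betw_def)
    then obtain e' where "e' \<in> gedges \<Gamma>'" "glabel \<Gamma>' e' = glabel \<Gamma> e"
      "gends \<Gamma>' e' = {f p, nb \<Gamma>' (glabel \<Gamma> e) (f p)}"
      using nb_edge[OF deterministicD(1)[OF R'] deterministicD(4)[OF R']] by metis
    then have "\<exists>e'. e' \<in> gedges \<Gamma>' \<and> glabel \<Gamma>' e' = glabel \<Gamma> e \<and> gends \<Gamma>' e' = f ` gends \<Gamma> e"
      using f_nb[OF pq(2)] by (auto simp: pq(1) q)
    then show ?thesis unfolding h_def by (rule someI_ex)
  qed
  have "inj_on h (gedges \<Gamma>)"
  proof (rule inj_onI)
    fix e1 e2 assume e: "e1 \<in> gedges \<Gamma>" "e2 \<in> gedges \<Gamma>" "h e1 = h e2"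
    have sub: "gends \<Gamma> e1 \<subseteq> gverts \<Gamma>" "gends \<Gamma> e2 \<subseteq> gverts \<Gamma>"
      using e deterministicD(1)[OF R] by (auto simp: wf_lgraph_def)
    have "gends \<Gamma> e1 = gends \<Gamma> e2"
      using h[OF e(1)] h[OF e(2)] e(3) sub bij by (metis bij_betw_def inj_on_image_eq_iff)
    moreover have "glabel \<Gamma> e1 = glabel \<Gamma> e2" using h[OF e(1)] h[OF e(2)] e(3) by metis
    moreover obtain p where "p \<in> gends \<Gamma> e1" "p \<in> gverts \<Gamma>"
      using e deterministicD(1)[OF R] by (auto simp: wf_lgraph_def)
    ultimately show "e1 = e2"
      using deterministicD(4)[OF R] e unfolding deterministic_at_def by metis
  qed
  moreover have "gedges \<Gamma>' \<subseteq> h ` gedges \<Gamma>"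
  proof
    fix e' assume e': "e' \<in> gedges \<Gamma>'"
    then obtain p' where p': "p' \<in> gends \<Gamma>' e'" "p' \<in> gverts \<Gamma>'"
      using deterministicD(1)[OF R'] by (auto simp: wf_lgraph_def)
    obtain p where p: "p' = f p" "p \<in> gverts \<Gamma>" using bij p'(2) by (metis bij_betw_imp_surj_on imageE)
    obtain e where e: "e \<in> gedges \<Gamma>" "p \<in> gends \<Gamma> e" "glabel \<Gamma> e = glabel \<Gamma>' e'"
      using deterministicD(4)[OF R p(2)] unfolding deterministic_at_def by metis
    have "e' = h e"
      using h[OF e(1)] e p p' e' deterministicD(4)[OF R' p'(2)]
      unfolding deterministic_at_def by (metis imageI)
    then show "e' \<in> h ` gedges \<Gamma>" using e by blast
  qed
  ultimately have "bij_betw h (gedges \<Gamma>) (gedges \<Gamma>')" using h by (auto simp: bij_betw_def)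
  moreover have "f r = r'" using f[of "[]"] by (simp add: w_def w'_def)
  ultimately show ?thesis using bij h by (intro rooted_isoI[of f _ _ h]) auto
qed

text \<open>This carries the line found in one representative of a class to all the others.\<close>

lemma nb_iso:
  assumes "deterministic (\<Gamma>, r)" "deterministic (\<Gamma>', r')" "rooted_iso (\<Gamma>, r) (\<Gamma>', r')"
  obtains f where "bij_betw f (gverts \<Gamma>) (gverts \<Gamma>')" "f r = r'"
    "\<And>p s. p \<in> gverts \<Gamma> \<Longrightarrow> nb \<Gamma>' s (f p) = f (nb \<Gamma> s p)"
proof -
  obtain f h where 1: "bij_betw f (gverts \<Gamma>) (gverts \<Gamma>')" "bij_betw h (gedges \<Gamma>) (gedges \<Gamma>')"
      "f r = r'" "\<forall>e\<in>gedges \<Gamma>. gends \<Gamma>' (h e) = f ` gends \<Gamma> e \<and> glabel \<Gamma>' (h e) = glabel \<Gamma> e"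
    using assms(3) by (auto simp: rooted_iso_def)
  have "nb \<Gamma>' s (f p) = f (nb \<Gamma> s p)" if p: "p \<in> gverts \<Gamma>" for p s
  proof -
    obtain e where e: "e \<in> gedges \<Gamma>" "glabel \<Gamma> e = s" "gends \<Gamma> e = {p, nb \<Gamma> s p}"
      using nb_edge[OF deterministicD(1)[OF assms(1)] deterministicD(4)[OF assms(1) p]] .
    have "f p \<in> gverts \<Gamma>'" "h e \<in> gedges \<Gamma>'" using 1 p e by (auto simp: bij_betw_def)
    then show ?thesis using 1(4) e deterministicD(4)[OF assms(2)]
      by (intro nb_eqI[of _ _ "h e"]) auto
  qed
  then show thesis using that 1 by blast
qed

section \<open>Isomorphic balls\<close>

definition ball_verts :: "nat \<Rightarrow> ('v, 'e) rooted_lgraph \<Rightarrow> 'v set" where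
  "ball_verts n R = {q \<in> gverts (fst R). \<exists>k\<le>n. (snd R, q) \<in> adjacency (fst R) ^^ k}"

lemma rooted_ball_eq:
  "rooted_ball n (\<Gamma>, r) = (\<Gamma>\<lparr>gverts := ball_verts n (\<Gamma>, r),
     gedges := {e \<in> gedges \<Gamma>. gends \<Gamma> e \<subseteq> ball_verts n (\<Gamma>, r)}\<rparr>, r)"
  by (simp add: rooted_ball_def ball_verts_def Let_def)

lemma ball_isoE:
  assumes "rooted_iso (rooted_ball n (\<Gamma>, r)) (rooted_ball n (\<Gamma>', r'))"
  obtains f h where
    "bij_betw f (ball_verts n (\<Gamma>, r)) (ball_verts n (\<Gamma>', r'))"
    "bij_betw h {e \<in> gedges \<Gamma>. gends \<Gamma> e \<subseteq> ball_verts n (\<Gamma>, r)}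
       {e \<in> gedges \<Gamma>'. gends \<Gamma>' e \<subseteq> ball_verts n (\<Gamma>', r')}"
    "f r = r'"
    "\<forall>e\<in>gedges \<Gamma>. gends \<Gamma> e \<subseteq> ball_verts n (\<Gamma>, r) \<longrightarrow>
       gends \<Gamma>' (h e) = f ` gends \<Gamma> e \<and> glabel \<Gamma>' (h e) = glabel \<Gamma> e"
  using assms unfolding rooted_iso_def rooted_ball_eq by auto

text \<open>Edges of the ball go to edges, so a path from the root inside the ball goes to a path of
  the same length. Hence an interior vertex has an interior image.\<close>

lemma ball_iso_distance:
  assumes wf: "wf_lgraph \<Gamma>" and r: "r \<in> gverts \<Gamma>"
    and f: "bij_betw f (ball_verts n (\<Gamma>, r)) (ball_verts n (\<Gamma>', r'))" "f r = r'"
    and h: "bij_betw h {e \<in> gedges \<Gamma>. gends \<Gamma> e \<subseteq> ball_verts n (\<Gamma>, r)}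
       {e \<in> gedges \<Gamma>'. gends \<Gamma>' e \<subseteq> ball_verts n (\<Gamma>', r')}"
    and fh: "\<And>e. e \<in> gedges \<Gamma> \<Longrightarrow> gends \<Gamma> e \<subseteq> ball_verts n (\<Gamma>, r) \<Longrightarrow>
       gends \<Gamma>' (h e) = f ` gends \<Gamma> e \<and> glabel \<Gamma>' (h e) = glabel \<Gamma> e"
    and "(r, p) \<in> adjacency \<Gamma> ^^ k" "k \<le> n"
  shows "p \<in> ball_verts n (\<Gamma>, r) \<and> (r', f p) \<in> adjacency \<Gamma>' ^^ k"
  using assms(7,8)
proof (induction k arbitrary: p)
  case 0
  then show ?case using r f by (auto simp: ball_verts_def intro!: exI[of _ 0])
next
  case (Suc k)
  then obtain q where q: "(r, q) \<in> adjacency \<Gamma> ^^ k" "(q, p) \<in> adjacency \<Gamma>" by auto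
  have p: "p \<in> ball_verts n (\<Gamma>, r)"
    using Suc.prems adjacency_in_gverts[OF wf q(2)] unfolding ball_verts_def by (simp, blast)
  have IH: "q \<in> ball_verts n (\<Gamma>, r)" "(r', f q) \<in> adjacency \<Gamma>' ^^ k"
    using Suc.IH[OF q(1)] Suc.prems(2) by auto
  obtain e where e: "e \<in> gedges \<Gamma>" "gends \<Gamma> e = {q, p}" using q(2) by (auto simp: adjacency_def)
  have "h e \<in> gedges \<Gamma>'" "gends \<Gamma>' (h e) = {f q, f p}"
    using e IH p h fh[of e] by (auto simp: bij_betw_def)
  then have "(f q, f p) \<in> adjacency \<Gamma>'" by (auto simp: adjacency_def)
  then show ?case using p IH by auto
qed

text \<open>A ball keeps only edges with all ends inside, so its outermost vertices may lack edges.
  At \<open>k < n\<close> steps from the root, all edges at \<open>p\<close> and all edges at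
  \<open>f p\<close> lie in their balls, and the isomorphism matches them label by label.
  Determinism is assumed of \<Gamma>' only, because for a limit graph it has to be derived.\<close>

lemma ball_iso_step:
  assumes wf: "wf_lgraph \<Gamma>" and r: "r \<in> gverts \<Gamma>" and R': "deterministic (\<Gamma>', r')"
    and f: "bij_betw f (ball_verts n (\<Gamma>, r)) (ball_verts n (\<Gamma>', r'))" "f r = r'"
    and h: "bij_betw h {e \<in> gedges \<Gamma>. gends \<Gamma> e \<subseteq> ball_verts n (\<Gamma>, r)}
       {e \<in> gedges \<Gamma>'. gends \<Gamma>' e \<subseteq> ball_verts n (\<Gamma>', r')}"
    and fh: "\<And>e. e \<in> gedges \<Gamma> \<Longrightarrow> gends \<Gamma> e \<subseteq> ball_verts n (\<Gamma>, r) \<Longrightarrow>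
       gends \<Gamma>' (h e) = f ` gends \<Gamma> e \<and> glabel \<Gamma>' (h e) = glabel \<Gamma> e"
    and k: "(r, p) \<in> adjacency \<Gamma> ^^ k" "k < n"
  shows "deterministic_at \<Gamma> p" "f (nb \<Gamma> s p) = nb \<Gamma>' s (f p)"
proof -
  let ?B = "ball_verts n (\<Gamma>, r)" and ?B' = "ball_verts n (\<Gamma>', r')"
  have p: "p \<in> ?B" "(r', f p) \<in> adjacency \<Gamma>' ^^ k"
    using ball_iso_distance[OF wf r f h fh k(1)] k(2) by auto
  have fp: "f p \<in> ?B'" using f(1) p by (auto simp: bij_betw_def)
  then have fp': "f p \<in> gverts \<Gamma>'" by (simp add: ball_verts_def)
  have inB: "gends \<Gamma> e \<subseteq> ?B" if e: "e \<in> gedges \<Gamma>" "p \<in> gends \<Gamma> e" for e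
  proof -
    obtain q where q: "gends \<Gamma> e = {p, q}" "q \<in> gverts \<Gamma>" using wf_ends_cases[OF wf e] .
    have "(r, q) \<in> adjacency \<Gamma> ^^ Suc k" using q e k(1) by (auto simp: adjacency_def)
    then show ?thesis using q p k(2) by (auto simp: ball_verts_def intro!: exI[of _ "Suc k"])
  qed
  have inB': "gends \<Gamma>' e \<subseteq> ?B'" if e: "e \<in> gedges \<Gamma>'" "f p \<in> gends \<Gamma>' e" for e
  proof -
    obtain q where q: "gends \<Gamma>' e = {f p, q}" "q \<in> gverts \<Gamma>'"
      using wf_ends_cases[OF deterministicD(1)[OF R'] e] .
    have "(r', q) \<in> adjacency \<Gamma>' ^^ Suc k" using q e p(2) by (auto simp: adjacency_def)
    then show ?thesis using q fp k(2) by (auto simp: ball_verts_def intro!: exI[of _ "Suc k"])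
  qed
  have det': "deterministic_at \<Gamma>' (f p)" using deterministicD(4)[OF R'] fp' by simp
  show det: "deterministic_at \<Gamma> p"
    unfolding deterministic_at_def
  proof (rule allI, rule ex_ex1I)
    fix s
    obtain e' where e': "e' \<in> gedges \<Gamma>'" "f p \<in> gends \<Gamma>' e'" "glabel \<Gamma>' e' = s"
      using det' unfolding deterministic_at_def by metis
    have "e' \<in> h ` {e \<in> gedges \<Gamma>. gends \<Gamma> e \<subseteq> ?B}"
      using h e' inB' by (auto simp: bij_betw_def)
    then obtain e where e: "e' = h e" "e \<in> gedges \<Gamma>" "gends \<Gamma> e \<subseteq> ?B" by blast
    have "f p \<in> f ` gends \<Gamma> e" using fh[OF e(2,3)] e' e by simp
    then have "p \<in> gends \<Gamma> e"
      using f(1) e(3) p(1) by (auto simp: bij_betw_def inj_on_def)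
    then show "\<exists>e. e \<in> gedges \<Gamma> \<and> p \<in> gends \<Gamma> e \<and> glabel \<Gamma> e = s"
      using e e' fh[OF e(2,3)] by auto
  next
    fix s e1 e2
    assume e1: "e1 \<in> gedges \<Gamma> \<and> p \<in> gends \<Gamma> e1 \<and> glabel \<Gamma> e1 = s"
      and e2: "e2 \<in> gedges \<Gamma> \<and> p \<in> gends \<Gamma> e2 \<and> glabel \<Gamma> e2 = s"
    have "h e1 \<in> gedges \<Gamma>'" "h e2 \<in> gedges \<Gamma>'" using h e1 e2 inB by (auto simp: bij_betw_def)
    moreover have "f p \<in> gends \<Gamma>' (h e1)" "f p \<in> gends \<Gamma>' (h e2)" "glabel \<Gamma>' (h e1) = s" "glabel \<Gamma>' (h e2) = s"
      using fh[of e1] fh[of e2] e1 e2 inB by auto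
    ultimately have "h e1 = h e2" using det' unfolding deterministic_at_def by metis
    then show "e1 = e2" using h e1 e2 inB by (auto simp: bij_betw_def inj_on_def)
  qed
  obtain e where e: "e \<in> gedges \<Gamma>" "glabel \<Gamma> e = s" "gends \<Gamma> e = {p, nb \<Gamma> s p}"
    using nb_edge[OF wf det] .
  have "gends \<Gamma> e \<subseteq> ?B" using inB[OF e(1)] e(3) by auto
  then have "h e \<in> gedges \<Gamma>'" "gends \<Gamma>' (h e) = {f p, f (nb \<Gamma> s p)}" "glabel \<Gamma>' (h e) = s"
    using h fh e by (auto simp: bij_betw_def)
  then show "f (nb \<Gamma> s p) = nb \<Gamma>' s (f p)" using nb_eqI[OF det'] by metis
qed

text \<open>Having one edge of each label at a vertex \<open>k\<close> steps from the root is
  visible in the ball of radius \<open>k + 1\<close>, so it passes to limits.\<close>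

lemma deterministic_if_ball_iso:
  assumes R: "rooted_connected (\<Gamma>, r)"
    and iso: "\<And>n. \<exists>\<Gamma>' r'. deterministic (\<Gamma>' :: ('w, 'd) lgraph, r') \<and>
      rooted_iso (rooted_ball n (\<Gamma>, r)) (rooted_ball n (\<Gamma>', r'))"
  shows "deterministic (\<Gamma>, r)"
proof -
  have wf: "wf_lgraph \<Gamma>" "r \<in> gverts \<Gamma>" using R by (auto simp: rooted_connected_def)
  have "deterministic_at \<Gamma> p" if "p \<in> gverts \<Gamma>" for p
  proof -
    have "(r, p) \<in> (adjacency \<Gamma>)\<^sup>*"
      using R that by (auto simp: rooted_connected_def connected_lgraph_def)
    then obtain k where k: "(r, p) \<in> adjacency \<Gamma> ^^ k" by (auto simp: rtrancl_power)
    obtain \<Gamma>' :: "('w, 'd) lgraph" and r' where R': "deterministic (\<Gamma>', r')"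
      and i: "rooted_iso (rooted_ball (Suc k) (\<Gamma>, r)) (rooted_ball (Suc k) (\<Gamma>', r'))"
      using iso by metis
    show ?thesis
      by (rule ball_isoE[OF i]) (rule ball_iso_step(1)[OF wf R' _ _ _ _ k]; blast)
  qed
  then show ?thesis using R by (auto simp: deterministic_def)
qed

lemma same_walks_if_ball_iso:
  assumes R: "deterministic (\<Gamma>, r)" and R': "deterministic (\<Gamma>', r')"
    and iso: "rooted_iso (rooted_ball n (\<Gamma>, r)) (rooted_ball n (\<Gamma>', r'))"
  shows "same_walks n (nb \<Gamma>) r (nb \<Gamma>') r'"
proof -
  note wf = deterministicD(1,2)[OF R]
  obtain f h where f1: "bij_betw f (ball_verts n (\<Gamma>, r)) (ball_verts n (\<Gamma>', r'))"
    and h: "bij_betw h {e \<in> gedges \<Gamma>. gends \<Gamma> e \<subseteq> ball_verts n (\<Gamma>, r)}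
       {e \<in> gedges \<Gamma>'. gends \<Gamma>' e \<subseteq> ball_verts n (\<Gamma>', r')}"
    and f2: "f r = r'"
    and "\<forall>e\<in>gedges \<Gamma>. gends \<Gamma> e \<subseteq> ball_verts n (\<Gamma>, r) \<longrightarrow>
       gends \<Gamma>' (h e) = f ` gends \<Gamma> e \<and> glabel \<Gamma>' (h e) = glabel \<Gamma> e"
    using ball_isoE[OF iso] .
  then have fh: "gends \<Gamma>' (h e) = f ` gends \<Gamma> e \<and> glabel \<Gamma>' (h e) = glabel \<Gamma> e"
    if "e \<in> gedges \<Gamma>" "gends \<Gamma> e \<subseteq> ball_verts n (\<Gamma>, r)" for e
    using that by blast
  note f = f1 f2
  have adj: "(r, foldr (nb \<Gamma>) g r) \<in> adjacency \<Gamma> ^^ length g" for g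
  proof (induction g)
    case (Cons s g)
    let ?p = "foldr (nb \<Gamma>) g r"
    obtain e where "e \<in> gedges \<Gamma>" "gends \<Gamma> e = {?p, nb \<Gamma> s ?p}"
      using nb_edge[OF wf(1) deterministicD(4)[OF R walk_in_gverts[OF R]]] by metis
    then have "(?p, nb \<Gamma> s ?p) \<in> adjacency \<Gamma>" by (auto simp: adjacency_def)
    then show ?case using Cons by auto
  qed simp
  have walk: "f (foldr (nb \<Gamma>) g r) = foldr (nb \<Gamma>') g r'" if "length g \<le> n" for g
    using that
  proof (induction g)
    case Nil
    then show ?case using f by simp
  next
    case (Cons s g)
    \<comment> \<open>The step starts at the end of a walk shorter than \<open>n\<close>, hence at
      an interior vertex.\<close>
    then show ?case using ball_iso_step(2)[OF wf R' f h fh adj[of g]] by simp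
  qed
  have inB: "foldr (nb \<Gamma>) g r \<in> ball_verts n (\<Gamma>, r)" if "length g \<le> n" for g
    using that adj[of g] walk_in_gverts[OF R] by (auto simp: ball_verts_def)
  show ?thesis unfolding same_walks_def
    using walk inB f(1) by (metis bij_betw_def inj_onD)
qed

text \<open>An isomorphism preserves distance from the root. Thus the ball of any member of a class
  can be exchanged for that of the Schreier graph itself.\<close>

lemma ball_iso_if_iso:
  assumes wf: "wf_lgraph \<Gamma>" "r \<in> gverts \<Gamma>" and wf': "wf_lgraph \<Gamma>'" "r' \<in> gverts \<Gamma>'"
    and iso: "rooted_iso (\<Gamma>, r) (\<Gamma>', r')"
  shows "rooted_iso (rooted_ball n (\<Gamma>, r)) (rooted_ball n (\<Gamma>', r'))"
proof -
  obtain f h where 1: "bij_betw f (gverts \<Gamma>) (gverts \<Gamma>')" "bij_betw h (gedges \<Gamma>) (gedges \<Gamma>')"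
      "f r = r'" "\<And>e. e\<in>gedges \<Gamma> \<Longrightarrow> gends \<Gamma>' (h e) = f ` gends \<Gamma> e \<and> glabel \<Gamma>' (h e) = glabel \<Gamma> e"
    using iso by (auto simp: rooted_iso_def)
  have sub: "gends \<Gamma> e \<subseteq> gverts \<Gamma>" if "e \<in> gedges \<Gamma>" for e
    using wf that by (auto simp: wf_lgraph_def)
  have adj1: "(p, q) \<in> adjacency \<Gamma> \<longleftrightarrow> (f p, f q) \<in> adjacency \<Gamma>'"
    if "p \<in> gverts \<Gamma>" "q \<in> gverts \<Gamma>" for p q
  proof
    assume "(p, q) \<in> adjacency \<Gamma>"
    then obtain e where "e \<in> gedges \<Gamma>" "gends \<Gamma> e = {p, q}" by (auto simp: adjacency_def)
    then have "h e \<in> gedges \<Gamma>'" "gends \<Gamma>' (h e) = {f p, f q}" using 1 by (auto simp: bij_betw_def)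
    then show "(f p, f q) \<in> adjacency \<Gamma>'" by (auto simp: adjacency_def)
  next
    assume "(f p, f q) \<in> adjacency \<Gamma>'"
    then obtain e' where e': "e' \<in> gedges \<Gamma>'" "gends \<Gamma>' e' = {f p, f q}" by (auto simp: adjacency_def)
    obtain e where e: "e \<in> gedges \<Gamma>" "e' = h e" using 1(2) e'(1) by (metis bij_betw_imp_surj_on imageE)
    have "f ` gends \<Gamma> e = f ` {p, q}" using 1(4)[OF e(1)] e e' by simp
    then have "gends \<Gamma> e = {p, q}"
      using inj_on_image_eq_iff[of f "gverts \<Gamma>" "gends \<Gamma> e" "{p, q}"] 1(1) that sub[OF e(1)]
      by (auto simp: bij_betw_def)
    then show "(p, q) \<in> adjacency \<Gamma>" using e by (auto simp: adjacency_def)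
  qed
  have adjk: "(r, p) \<in> adjacency \<Gamma> ^^ k \<longleftrightarrow> (r', f p) \<in> adjacency \<Gamma>' ^^ k" if "p \<in> gverts \<Gamma>" for p k
    using that
  proof (induction k arbitrary: p)
    case 0
    then show ?case using 1 wf by (auto simp: bij_betw_def inj_on_def)
  next
    case (Suc k)
    show ?case
    proof
      assume "(r, p) \<in> adjacency \<Gamma> ^^ Suc k"
      then obtain q where "(r, q) \<in> adjacency \<Gamma> ^^ k" "(q, p) \<in> adjacency \<Gamma>" by auto
      then show "(r', f p) \<in> adjacency \<Gamma>' ^^ Suc k"
        using adjacency_in_gverts[OF wf(1)] Suc.IH adj1 by (metis relpow_Suc_I)
    next
      assume "(r', f p) \<in> adjacency \<Gamma>' ^^ Suc k"
      then obtain q' where q': "(r', q') \<in> adjacency \<Gamma>' ^^ k" "(q', f p) \<in> adjacency \<Gamma>'" by auto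
      then obtain q where "q' = f q" "q \<in> gverts \<Gamma>"
        using adjacency_in_gverts[OF wf'(1) q'(2)] 1(1) by (metis bij_betw_imp_surj_on imageE)
      then show "(r, p) \<in> adjacency \<Gamma> ^^ Suc k" using q' Suc adj1 by (metis relpow_Suc_I)
    qed
  qed
  let ?B = "ball_verts n (\<Gamma>, r)" and ?B' = "ball_verts n (\<Gamma>', r')"
  have B: "f p \<in> ?B' \<longleftrightarrow> p \<in> ?B" if "p \<in> gverts \<Gamma>" for p
    using that adjk 1(1) by (auto simp: ball_verts_def bij_betw_def)
  have "?B \<subseteq> gverts \<Gamma>" "?B' \<subseteq> gverts \<Gamma>'" by (auto simp: ball_verts_def)
  then have "f ` ?B = ?B'" using B 1(1) by (fastforce simp: bij_betw_def)
  then have fB: "bij_betw f ?B ?B'"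
    using 1(1) \<open>?B \<subseteq> gverts \<Gamma>\<close> by (auto simp: bij_betw_def intro: inj_on_subset)
  have E: "gends \<Gamma>' (h e) \<subseteq> ?B' \<longleftrightarrow> gends \<Gamma> e \<subseteq> ?B" if "e \<in> gedges \<Gamma>" for e
    using 1(4)[OF that] sub[OF that] B by (auto simp: subset_iff)
  have "h ` {e \<in> gedges \<Gamma>. gends \<Gamma> e \<subseteq> ?B} = {e \<in> gedges \<Gamma>'. gends \<Gamma>' e \<subseteq> ?B'}"
  proof
    show "{e \<in> gedges \<Gamma>'. gends \<Gamma>' e \<subseteq> ?B'} \<subseteq> h ` {e \<in> gedges \<Gamma>. gends \<Gamma> e \<subseteq> ?B}"
    proof
      fix e' assume e': "e' \<in> {e \<in> gedges \<Gamma>'. gends \<Gamma>' e \<subseteq> ?B'}"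
      then obtain e where "e \<in> gedges \<Gamma>" "e' = h e" using 1(2) by (auto simp: bij_betw_def image_iff)
      then show "e' \<in> h ` {e \<in> gedges \<Gamma>. gends \<Gamma> e \<subseteq> ?B}" using E e' by blast
    qed
  qed (use E 1(2) in \<open>auto simp: bij_betw_def\<close>)
  then have "bij_betw h {e \<in> gedges \<Gamma>. gends \<Gamma> e \<subseteq> ?B} {e \<in> gedges \<Gamma>'. gends \<Gamma>' e \<subseteq> ?B'}"
    using 1(2) by (auto simp: bij_betw_def intro: inj_on_subset)
  then show ?thesis using fB 1(3,4) unfolding rooted_ball_eq by (intro rooted_isoI[of f _ _ h]) auto
qed

section \<open>Limits of Schreier graphs\<close>

lemma gen_act_Bij: "gen_act s \<in> carrier (BijGroup UNIV)"
  by (auto simp: BijGroup_def Bij_def intro!: bij_betwI[where g = "gen_act s"])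

text \<open>\<open>boundary_act\<close> reads a letter of the image off the image of a prefix, which
  is consistent because group elements keep lengths and commute with truncation. Both properties
  pass to products, and each generator is its own inverse.\<close>

lemma grigorchuk_prefix:
  assumes "h \<in> grigorchuk"
  shows "h \<in> carrier (BijGroup UNIV) \<and> (\<forall>w. length (h w) = length w) \<and>
    (\<forall>n w. take n (h w) = h (take n w))"
proof -
  interpret group "BijGroup (UNIV :: bool list set)" by (rule group_BijGroup)
  have sq: "gen_act s \<otimes>\<^bsub>BijGroup UNIV\<^esub> gen_act s = \<one>\<^bsub>BijGroup UNIV\<^esub>" for s
    using gen_act_Bij[of s] by (auto simp: BijGroup_def compose_def)
  have inv: "inv\<^bsub>BijGroup UNIV\<^esub> gen_act s = gen_act s" for s
    by (rule inv_equality[OF sq gen_act_Bij gen_act_Bij])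
  show ?thesis
    using assms unfolding grigorchuk_def
  proof (induction rule: generate.induct)
    case one
    have "\<one>\<^bsub>BijGroup UNIV\<^esub> = (\<lambda>w :: bool list. w)" by (auto simp: BijGroup_def)
    then show ?case using one_closed by simp
  next
    case (incl h)
    then show ?case using gen_act_Bij by (auto simp: take_gen_act)
  next
    case (inv h)
    then show ?case using gen_act_Bij by (auto simp: take_gen_act \<open>\<And>s. inv\<^bsub>BijGroup UNIV\<^esub> gen_act s = gen_act s\<close>)
  next
    case (eng h1 h2)
    then have "h1 \<otimes>\<^bsub>BijGroup UNIV\<^esub> h2 = h1 \<circ> h2"
      by (auto simp: BijGroup_def compose_def fun_eq_iff)
    then show ?case using eng m_closed[of h1 h2] by (auto simp: comp_def)
  qed
qed

lemma map_boundary_act: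
  assumes "\<forall>w. length (h w) = length w" "\<forall>n w. take n (h w) = h (take n w)"
  shows "map (boundary_act h \<xi>) [0..<n] = h (map \<xi> [0..<n])"
proof (rule nth_equalityI)
  fix i assume "i < length (map (boundary_act h \<xi>) [0..<n])"
  then have i: "i < n" by simp
  then have "take (Suc i) (map \<xi> [0..<n]) = map \<xi> [0..<Suc i]"
    by (simp add: take_map del: upt_Suc)
  then have "h (map \<xi> [0..<Suc i]) ! i = take (Suc i) (h (map \<xi> [0..<n])) ! i"
    using assms(2) by metis
  then show "map (boundary_act h \<xi>) [0..<n] ! i = h (map \<xi> [0..<n]) ! i"
    using i by (simp add: boundary_act_def del: upt_Suc)
qed (use assms(1) in simp)

lemma bact_boundary_act:
  assumes "\<forall>w. length (h w) = length w" "\<forall>n w. take n (h w) = h (take n w)"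
  shows "bact s (boundary_act h \<xi>) = boundary_act (gen_act s \<circ> h) \<xi>"
  unfolding boundary_act_def[of "gen_act s"] boundary_act_def[of "gen_act s \<circ> h"]
    map_boundary_act[OF assms] by simp

lemma bact_involution [simp]: "bact s (bact s \<xi>) = \<xi>"
proof
  fix n
  show "bact s (bact s \<xi>) n = \<xi> n"
    by (subst bact_boundary_act) (simp_all add: take_gen_act boundary_act_def del: upt_Suc)
qed

lemma bact_in_orbit:
  assumes "p \<in> boundary_orbit \<xi>" shows "bact s p \<in> boundary_orbit \<xi>"
proof -
  obtain h where h: "h \<in> grigorchuk" "p = boundary_act h \<xi>"
    using assms by (auto simp: boundary_orbit_def)
  note pre = grigorchuk_prefix[OF h(1)]
  have "gen_act s \<otimes>\<^bsub>BijGroup UNIV\<^esub> h \<in> grigorchuk"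
    unfolding grigorchuk_def
    by (rule generate.eng[OF generate.incl[OF rangeI] h(1)[unfolded grigorchuk_def]])
  moreover have "gen_act s \<otimes>\<^bsub>BijGroup UNIV\<^esub> h = gen_act s \<circ> h"
    using pre gen_act_Bij[of s] by (auto simp: BijGroup_def compose_def fun_eq_iff)
  ultimately show ?thesis
    using pre by (auto simp: boundary_orbit_def h(2) bact_boundary_act)
qed

text \<open>Connectedness comes from \<open>rooted_iso_rel\<close>: a Schreier graph is related to
  anything at all only if it is connected.\<close>

lemma deterministic_schreier:
  assumes "rooted_connected (schreier_graph \<xi>, \<xi>)"
  shows "deterministic (schreier_graph \<xi>, \<xi>)"
    and "p \<in> boundary_orbit \<xi> \<Longrightarrow> nb (schreier_graph \<xi>) s p = bact s p"
proof -
  let ?G = "schreier_graph \<xi>"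
  have edge: "(s, {p, bact s p}) \<in> gedges ?G" if "p \<in> boundary_orbit \<xi>" for s p
    using that bact_in_orbit[OF that] by (auto simp: schreier_graph_def)
  have det: "deterministic_at ?G p" if p: "p \<in> boundary_orbit \<xi>" for p
    unfolding deterministic_at_def
  proof (rule allI, rule ex1I)
    fix s
    show "(s, {p, bact s p}) \<in> gedges ?G \<and> p \<in> gends ?G (s, {p, bact s p}) \<and>
        glabel ?G (s, {p, bact s p}) = s"
      using edge[OF p] by (auto simp: schreier_graph_def)
    fix e assume e: "e \<in> gedges ?G \<and> p \<in> gends ?G e \<and> glabel ?G e = s"
    then obtain p' where "e = (s, {p', bact s p'})" "p \<in> {p', bact s p'}"
      by (auto simp: schreier_graph_def)
    then show "e = (s, {p, bact s p})" by (auto simp: insert_commute)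
  qed
  have "gverts ?G = boundary_orbit \<xi>" by (simp add: schreier_graph_def)
  then show "deterministic (?G, \<xi>)" using assms det by (simp add: deterministic_def)
  show "nb ?G s p = bact s p" if "p \<in> boundary_orbit \<xi>"
    using that by (intro nb_eqI[OF det _ _ _, of p "(s, {p, bact s p})"] edge)
      (auto simp: schreier_graph_def)
qed

lemma schreier_walk:
  assumes "rooted_connected (schreier_graph \<xi>, \<xi>)"
  shows "foldr (nb (schreier_graph \<xi>)) g \<xi> = foldr bact g \<xi>"
proof (induction g)
  case (Cons s g)
  have "foldr (nb (schreier_graph \<xi>)) g \<xi> \<in> boundary_orbit \<xi>"
    using walk_in_gverts[OF deterministic_schreier(1)[OF assms]] by (simp add: schreier_graph_def)
  then show ?case using deterministic_schreier(2)[OF assms] Cons by simp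
qed simp

lemma same_walksD:
  "same_walks n act r act' r' \<Longrightarrow> length g \<le> n \<Longrightarrow> length k \<le> n \<Longrightarrow>
     foldr act g r = foldr act k r \<longleftrightarrow> foldr act' g r' = foldr act' k r'"
  by (simp add: same_walks_def)

section \<open>Classes in the closure\<close>

lemma graph_nbhd_open:
  "rooted_connected R \<Longrightarrow> openin local_topology (graph_nbhd n R)"
  unfolding local_topology_def by (intro topology_generated_by_Basis) blast

lemma graph_space_class:
  assumes "x \<in> graph_space" "R \<in> x"
  shows "rooted_connected R" "x = rooted_iso_rel `` {R}"
proof -
  obtain R0 where R0: "x = rooted_iso_rel `` {R0}"
    using assms(1) unfolding graph_space_def by (rule quotientE)
  then have rel: "(R0, R) \<in> rooted_iso_rel" using assms(2) by simp
  then show "rooted_connected R" by (auto simp: rooted_iso_rel_def)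
  show "x = rooted_iso_rel `` {R}"
    unfolding R0 by (rule equiv_class_eq[OF equiv_rooted_iso_rel rel])
qed

text \<open>Each neighbourhood given by a ball of a member of \<open>x\<close> meets the Schreier
  classes, so this ball is also a ball of a Schreier graph. The approximating point \<eta> depends
  on the radius \<open>n\<close>.\<close>

lemma schreier_closureD:
  assumes x: "x \<in> schreier_closure"
  shows "x \<in> graph_space"
    and "(\<Gamma>, r) \<in> x \<Longrightarrow> deterministic (\<Gamma>, r)"
    and "(\<Gamma>, r) \<in> x \<Longrightarrow> \<exists>\<eta>. same_walks n (nb \<Gamma>) r bact \<eta>"
proof -
  have top: "x \<in> topspace local_topology"
    using x by (auto simp: schreier_closure_def in_closure_of)
  then show space: "x \<in> graph_space"
    by (auto simp: local_topology_def topology_generated_by_topspace graph_nbhd_def)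
  have near: "\<exists>\<eta>. deterministic (schreier_graph \<eta>, \<eta>) \<and> rooted_connected (schreier_graph \<eta>, \<eta>) \<and>
      rooted_iso (rooted_ball n (\<Gamma>, r)) (rooted_ball n (schreier_graph \<eta>, \<eta>))"
    if R: "(\<Gamma>, r) \<in> x" for n \<Gamma> r
  proof -
    note R' = graph_space_class[OF space R]
    have "x \<in> graph_nbhd n (\<Gamma>, r)"
      using space R by (auto simp: graph_nbhd_def intro!: bexI[of _ "(\<Gamma>, r)"] rooted_iso_refl)
    then obtain y where "y \<in> range schreier_class" "y \<in> graph_nbhd n (\<Gamma>, r)"
      using x graph_nbhd_open[OF R'(1)] unfolding schreier_closure_def in_closure_of by blast
    then obtain \<eta> \<Gamma>' r' where \<eta>: "(\<Gamma>', r') \<in> schreier_class \<eta>"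
        "rooted_iso (rooted_ball n (\<Gamma>, r)) (rooted_ball n (\<Gamma>', r'))"
      by (auto simp: graph_nbhd_def)
    then have rel: "((schreier_graph \<eta>, \<eta>), (\<Gamma>', r')) \<in> rooted_iso_rel"
      by (simp add: schreier_class_def)
    then have con: "rooted_connected (schreier_graph \<eta>, \<eta>)" by (simp add: rooted_iso_rel_def)
    have "((\<Gamma>', r'), (schreier_graph \<eta>, \<eta>)) \<in> rooted_iso_rel"
      using rel equiv_rooted_iso_rel by (meson equivE symD)
    then have "rooted_iso (rooted_ball n (\<Gamma>', r')) (rooted_ball n (schreier_graph \<eta>, \<eta>))"
      by (intro ball_iso_if_iso) (auto simp: rooted_iso_rel_def rooted_connected_def)
    then show ?thesis using \<eta>(2) con deterministic_schreier(1)[OF con] rooted_iso_trans by blast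
  qed
  show det: "deterministic (\<Gamma>, r)" if R: "(\<Gamma>, r) \<in> x"
    using near[OF R] by (intro deterministic_if_ball_iso[OF graph_space_class(1)[OF space R]]) blast
  show "\<exists>\<eta>. same_walks n (nb \<Gamma>) r bact \<eta>" if R: "(\<Gamma>, r) \<in> x"
  proof -
    obtain \<eta> where \<eta>: "deterministic (schreier_graph \<eta>, \<eta>)" "rooted_connected (schreier_graph \<eta>, \<eta>)"
      "rooted_iso (rooted_ball n (\<Gamma>, r)) (rooted_ball n (schreier_graph \<eta>, \<eta>))"
      using near[OF R] by blast
    have "same_walks n (nb \<Gamma>) r (nb (schreier_graph \<eta>)) \<eta>"
      by (rule same_walks_if_ball_iso[OF det[OF R] \<eta>(1,3)])
    then show ?thesis by (auto simp: same_walks_def schreier_walk[OF \<eta>(2)])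
  qed
qed

section \<open>Vertices with three loops and isolated classes\<close>

lemma first_zero_exists:
  fixes \<xi> :: boundary
  assumes "\<xi> \<noteq> (\<lambda>_. True)"
  obtains m where "\<forall>i<m. \<xi> i" "\<not> \<xi> m"
proof -
  have "\<exists>m. \<not> \<xi> m" using assms by auto
  then show thesis using that unfolding exists_least_iff[of "\<lambda>m. \<not> \<xi> m"] by blast
qed

text \<open>If there is a zero, only one of \<open>b\<close>, \<open>c\<close>, \<open>d\<close>
  fixes the point, so \<open>b\<close> or \<open>c\<close> moves it.\<close>

lemma bact_fixed_imp_all_ones:
  assumes "bact Gb \<xi> = \<xi>" "bact Gc \<xi> = \<xi>" "bact Gd \<xi> = \<xi>"
  shows "\<xi> = (\<lambda>_. True)"
proof (rule ccontr)
  assume "\<xi> \<noteq> (\<lambda>_. True)"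
  then obtain m where m: "\<forall>i<m. \<xi> i" "\<not> \<xi> m" by (rule first_zero_exists)
  have "\<xi>(Suc m := \<not> \<xi> (Suc m)) \<noteq> \<xi>" by (metis fun_upd_same)
  then show False
    using assms bact_first_zero[OF m, of Gb] bact_first_zero[OF m, of Gc]
    by (auto split: if_splits)
qed

lemma walk_rev_cancel: "foldr bact (rev g) (foldr bact g \<xi>) = \<xi>"
  by (induction g) auto

text \<open>The only boundary point fixed by \<open>b\<close>, \<open>c\<close> and \<open>d\<close> is \<open>1\<^sup>\<infinity>\<close>, so a ball containing a vertex
  with three loops determines the root of every approximating Schreier graph.\<close>

lemma X_space_no_triple_loop:
  assumes x: "x \<in> X_space" and R: "(\<Gamma>, r) \<in> x" and p: "p \<in> gverts \<Gamma>"
  shows "\<not> (nb \<Gamma> Gb p = p \<and> nb \<Gamma> Gc p = p \<and> nb \<Gamma> Gd p = p)"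
proof
  assume fix': "nb \<Gamma> Gb p = p \<and> nb \<Gamma> Gc p = p \<and> nb \<Gamma> Gd p = p"
  have xc: "x \<in> schreier_closure" using x by (simp add: X_space_def)
  note xD = schreier_closureD[OF xc]
  obtain g where g: "p = foldr (nb \<Gamma>) g r" using gverts_eq_walks[OF xD(2)[OF R]] p by auto
  \<comment> \<open>One more than the length of the walk to \<open>p\<close>, so that the loops at
    \<open>p\<close> are seen as well.\<close>
  define n where "n = Suc (length g)"
  define triple where "triple \<Delta> q \<longleftrightarrow> (\<forall>s\<in>{Gb, Gc, Gd}. foldr \<Delta> (s # g) q = foldr \<Delta> g q)"
    for \<Delta> :: "gen \<Rightarrow> boundary \<Rightarrow> boundary" and q
  \<comment> \<open>The walk \<open>g\<close> must end at the all-ones point, and walking back along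
    involutions recovers its start.\<close>
  have root: "\<eta> = foldr bact (rev g) (\<lambda>_. True)"
    if "triple (nb \<Delta>) q" "same_walks m (nb \<Delta>) q bact \<eta>" "n \<le> m"
    for \<Delta> :: "(boundary, schreier_edge) lgraph" and q \<eta> m
  proof -
    have "foldr bact (s # g) \<eta> = foldr bact g \<eta>" if "s \<in> {Gb, Gc, Gd}" for s
      using same_walksD[OF \<open>same_walks m (nb \<Delta>) q bact \<eta>\<close>, of "s # g" g] that
        \<open>triple (nb \<Delta>) q\<close> \<open>n \<le> m\<close> unfolding triple_def n_def by auto
    then have "foldr bact g \<eta> = (\<lambda>_. True)" by (intro bact_fixed_imp_all_ones) auto
    then show ?thesis using walk_rev_cancel by metis
  qed
  have tr: "triple (nb \<Gamma>) r" using fix' g by (auto simp: triple_def)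
  have "y = x" if y: "y \<in> schreier_closure" "y \<in> graph_nbhd n (\<Gamma>, r)" for y
  proof -
    note yD = schreier_closureD[OF y(1)]
    obtain \<Gamma>' r' where R': "(\<Gamma>', r') \<in> y"
      and iso: "rooted_iso (rooted_ball n (\<Gamma>, r)) (rooted_ball n (\<Gamma>', r'))"
      using y(2) by (auto simp: graph_nbhd_def)
    have same: "same_walks n (nb \<Gamma>) r (nb \<Gamma>') r'"
      by (rule same_walks_if_ball_iso[OF xD(2)[OF R] yD(2)[OF R'] iso])
    have tr': "triple (nb \<Gamma>') r'"
      unfolding triple_def
    proof
      fix s assume "s \<in> {Gb, Gc, Gd}"
      then show "foldr (nb \<Gamma>') (s # g) r' = foldr (nb \<Gamma>') g r'"
        using same_walksD[OF same, of "s # g" g] tr unfolding triple_def n_def by auto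
    qed
    have "same_walks m (nb \<Gamma>) r (nb \<Gamma>') r'" for m
    proof -
      \<comment> \<open>Large enough both for walks of length \<open>m\<close> and for the loops at
        \<open>p\<close>, which force the two graphs to share their approximating point.\<close>
      define N where "N = max m n"
      obtain \<eta> \<eta>' where \<eta>: "same_walks N (nb \<Gamma>) r bact \<eta>" "same_walks N (nb \<Gamma>') r' bact \<eta>'"
        using xD(3)[OF R] yD(3)[OF R'] by blast
      have "\<eta> = \<eta>'" using root[OF tr \<eta>(1)] root[OF tr' \<eta>(2)] by (simp add: N_def)
      then show ?thesis using \<eta> unfolding same_walks_def N_def by (metis max.coboundedI1)
    qed
    then have "rooted_iso (\<Gamma>, r) (\<Gamma>', r')"
      by (rule rooted_iso_if_same_walks[OF xD(2)[OF R] yD(2)[OF R']])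
    then have "((\<Gamma>, r), (\<Gamma>', r')) \<in> rooted_iso_rel"
      using graph_space_class(1)[OF xD(1) R] graph_space_class(1)[OF yD(1) R']
      by (simp add: rooted_iso_rel_def)
    then show "y = x"
      using graph_space_class(2)[OF xD(1) R] graph_space_class(2)[OF yD(1) R']
        equiv_class_eq[OF equiv_rooted_iso_rel] by metis
  qed
  moreover have "x \<in> graph_nbhd n (\<Gamma>, r)"
    using xD(1) R by (auto simp: graph_nbhd_def intro!: bexI[of _ "(\<Gamma>, r)"] rooted_iso_refl)
  ultimately have "graph_nbhd n (\<Gamma>, r) \<inter> schreier_closure = {x}" using xc by blast
  then have "x \<in> isolated_points_of local_topology schreier_closure"
    using xc graph_nbhd_open[OF graph_space_class(1)[OF xD(1) R]]
    unfolding isolated_points_of_def by blast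
  then show False using x by (simp add: X_space_def)
qed

section \<open>Operators\<close>

text \<open>Determinism makes \<open>glabel\<close> a bijection from the edges at \<open>p\<close>
  onto the four labels, so parallel edges are counted separately and a loop contributes one term at
  \<open>p\<close>.\<close>

lemma laplacian_nb:
  assumes R: "deterministic (\<Gamma>, r)" and p: "p \<in> gverts \<Gamma>"
  shows "laplacian t u v w \<Gamma> \<phi> p =
    of_real t * \<phi> (nb \<Gamma> Ga p) + of_real u * \<phi> (nb \<Gamma> Gb p) +
    of_real v * \<phi> (nb \<Gamma> Gc p) + of_real w * \<phi> (nb \<Gamma> Gd p)"
proof -
  note det = deterministicD(4)[OF R p]
  have bij: "bij_betw (glabel \<Gamma>) (incident_edges \<Gamma> p) UNIV"
    using det unfolding deterministic_at_def bij_betw_def inj_on_def incident_edges_def surj_def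
    by (auto simp: image_iff) metis+
  have other: "other_end \<Gamma> p e = nb \<Gamma> (glabel \<Gamma> e) p" if "e \<in> incident_edges \<Gamma> p" for e
  proof -
    have e: "e \<in> gedges \<Gamma>" "p \<in> gends \<Gamma> e" using that by (auto simp: incident_edges_def)
    obtain q where q: "gends \<Gamma> e = {p, q}" using wf_ends_cases[OF deterministicD(1)[OF R] e] by metis
    then have "other_end \<Gamma> p e = q" unfolding other_end_def by (auto simp: doubleton_eq_iff)
    then show ?thesis using nb_eqI[OF det e(1) _ q] by simp
  qed
  have UNIV_gen: "(UNIV :: gen set) = {Ga, Gb, Gc, Gd}" using gen.exhaust by auto
  have "laplacian t u v w \<Gamma> \<phi> p = (\<Sum>e\<in>incident_edges \<Gamma> p.
      of_real (edge_weight t u v w (glabel \<Gamma> e)) * \<phi> (nb \<Gamma> (glabel \<Gamma> e) p))"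
    using p other by (simp add: laplacian_def)
  also have "\<dots> = (\<Sum>s\<in>UNIV. of_real (edge_weight t u v w s) * \<phi> (nb \<Gamma> s p))"
    by (rule sum.reindex_bij_betw[OF bij])
  finally show ?thesis by (simp add: UNIV_gen edge_weight_def)
qed

text \<open>The unitary map renames the basis along \<open>P\<close>; extending by zero outside
  \<open>V\<close> matches the convention of \<open>ell2_space\<close>.\<close>

lemma unitarily_equivalent_bij:
  fixes P :: "'i \<Rightarrow> 'j"
  assumes P: "bij_betw P UNIV V"
    and AB: "\<And>\<psi> n. B \<psi> (P n) = A (\<psi> \<circ> P) n"
    and out: "\<And>\<psi> q. q \<notin> V \<Longrightarrow> B \<psi> q = 0"
  shows "unitarily_equivalent UNIV A V B"
proof -
  define U :: "('i \<Rightarrow> complex) \<Rightarrow> 'j \<Rightarrow> complex"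
    where "U \<phi> = (\<lambda>q. if q \<in> V then \<phi> (the_inv P q) else 0)" for \<phi>
  have V: "V = range P" and inj: "inj P" using P by (auto simp: bij_betw_def)
  have UP [simp]: "U \<phi> (P n) = \<phi> n" for \<phi> n
    by (simp add: U_def V the_inv_f_f[OF inj])
  have Uout [simp]: "q \<notin> V \<Longrightarrow> U \<phi> q = 0" for q \<phi> by (simp add: U_def)
  have eqI: "\<psi> = \<psi>'" if "\<And>n. \<psi> (P n) = \<psi>' (P n)" "\<And>q. q \<notin> V \<Longrightarrow> \<psi> q = \<psi>' q"
    for \<psi> \<psi>' :: "'j \<Rightarrow> complex"
  proof
    fix q show "\<psi> q = \<psi>' q" using that by (cases "q \<in> V") (auto simp: V)
  qed
  have summ: "(\<lambda>q. (cmod (\<psi> q))\<^sup>2) summable_on V \<longleftrightarrow> (\<lambda>n. (cmod (\<psi> (P n)))\<^sup>2) summable_on UNIV"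
    for \<psi> :: "'j \<Rightarrow> complex"
    by (rule summable_on_reindex_bij_betw[OF P, symmetric])
  have "bij_betw U (ell2_space UNIV) (ell2_space V)"
  proof (rule bij_betwI[where g = "\<lambda>\<psi>. \<psi> \<circ> P"])
    show "U \<in> ell2_space UNIV \<rightarrow> ell2_space V" by (auto simp: ell2_space_def summ)
    show "(\<lambda>\<psi>. \<psi> \<circ> P) \<in> ell2_space V \<rightarrow> ell2_space UNIV" by (auto simp: ell2_space_def summ)
    show "U \<phi> \<circ> P = \<phi>" for \<phi> by auto
    show "U (\<psi> \<circ> P) = \<psi>" if "\<psi> \<in> ell2_space V" for \<psi>
      using that by (intro eqI) (auto simp: ell2_space_def)
  qed
  moreover have "ell2_inner V (U \<phi>) (U \<psi>) = ell2_inner UNIV \<phi> \<psi>" for \<phi> \<psi>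
    unfolding ell2_inner_def
    using infsum_reindex_bij_betw[OF P, of "\<lambda>q. cnj (U \<phi> q) * U \<psi> q"] by simp
  ultimately have "unitary_between UNIV V U"
    unfolding unitary_between_def by (auto simp: U_def)
  moreover have "U (A \<phi>) = B (U \<phi>)" for \<phi>
  proof (rule eqI)
    have "U \<phi> \<circ> P = \<phi>" by auto
    then show "U (A \<phi>) (P n) = B (U \<phi>) (P n)" for n by (simp add: AB)
  qed (simp add: out)
  ultimately show ?thesis unfolding unitarily_equivalent_def by blast
qed

section \<open>The line and its word\<close>

lemma bact_all_ones:
  assumes "s \<noteq> Ga" shows "bact s (\<lambda>_. True) = (\<lambda>_. True)"
proof
  fix n
  let ?o = "\<lambda>_. True"
  note rec = fun_cong[OF bact_rec(1)[of ?o]] fun_cong[OF bact_rec(2)[of ?o]] fun_cong[OF bact_rec(3)[of ?o]]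
  show "bact s ?o n = True" using assms
  proof (induction n arbitrary: s)
    case 0
    then show ?case using rec[of 0] by (cases s) auto
  next
    case (Suc n)
    then show ?case using rec[of "Suc n"] by (cases s) auto
  qed
qed

lemma loop_gen_neq_Ga [simp]: "l \<noteq> La \<Longrightarrow> loop_gen l \<noteq> Ga"
  by (cases l) auto

lemma loop_gen_inj: "loop_gen l = loop_gen l' \<Longrightarrow> l = l'"
  by (cases l; cases l') auto

lemma ex_moving_gen: "\<exists>s. s \<noteq> Ga \<and> s \<noteq> loop_gen l"
  by (cases l) (auto intro: gen.distinct)

text \<open>The end of the \<open>s\<close>-edge at \<open>n\<close> if \<open>\<omega> n\<close> is the letter between the vertices \<open>n\<close> and \<open>n + 1\<close>.\<close>

definition line_nb :: "(int \<Rightarrow> letter) \<Rightarrow> gen \<Rightarrow> int \<Rightarrow> int" where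
  "line_nb \<omega> s n =
     (if s = Ga then if \<omega> n = La then n + 1 else n - 1
      else if s = loop_gen (if \<omega> n = La then \<omega> (n - 1) else \<omega> n) then n
      else if \<omega> n = La then n - 1 else n + 1)"

primrec zigzag :: "('v \<Rightarrow> 'v) \<Rightarrow> ('v \<Rightarrow> 'v) \<Rightarrow> 'v \<Rightarrow> nat \<Rightarrow> 'v" where
  "zigzag A M r 0 = r"
| "zigzag A M r (Suc n) = (if even n then A else M) (zigzag A M r n)"

text \<open>The two maps exchange roles on the negative side, so that for involutions every even
  index has \<open>A\<close> to its right and \<open>M\<close> to its left.\<close>

definition zigzag_line :: "('v \<Rightarrow> 'v) \<Rightarrow> ('v \<Rightarrow> 'v) \<Rightarrow> 'v \<Rightarrow> int \<Rightarrow> 'v" where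
  "zigzag_line A M r i = (if i \<ge> 0 then zigzag A M r (nat i) else zigzag M A r (nat (- i)))"

lemma zigzag_in:
  assumes "r \<in> V" "\<And>p. p \<in> V \<Longrightarrow> A p \<in> V" "\<And>p. p \<in> V \<Longrightarrow> M p \<in> V"
  shows "zigzag A M r n \<in> V"
  using assms by (induction n) auto

lemma zigzag_line:
  assumes V: "r \<in> V" "\<And>p. p \<in> V \<Longrightarrow> A p \<in> V" "\<And>p. p \<in> V \<Longrightarrow> M p \<in> V"
    and inv: "\<And>p. p \<in> V \<Longrightarrow> A (A p) = p" "\<And>p. p \<in> V \<Longrightarrow> M (M p) = p"
  defines "P \<equiv> zigzag_line A M r"
  shows "P i \<in> V" "P (i + 1) = (if even i then A else M) (P i)"
    "P (i - 1) = (if even i then M else A) (P i)"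
proof -
  show P: "P i \<in> V" for i
    using zigzag_in[of r V A M] zigzag_in[of r V M A] V by (auto simp: P_def zigzag_line_def)
  have step: "P (i + 1) = (if even i then A else M) (P i)" for i
  proof (cases "i \<ge> 0")
    case True
    then have "nat (i + 1) = Suc (nat i)" "even (nat i) \<longleftrightarrow> even i" by (auto simp: even_nat_iff)
    then show ?thesis using True by (simp add: P_def zigzag_line_def)
  next
    case False
    define k where "k = nat (- i - 1)"
    have i: "i = - int (Suc k)" using False by (simp add: k_def)
    have "P (i + 1) = zigzag M A r k" by (cases k) (auto simp: i P_def zigzag_line_def nat_add_distrib)
    moreover have "P i = (if even k then M else A) (zigzag M A r k)"
      using False by (simp add: i P_def zigzag_line_def del: of_nat_Suc)
    moreover have "even k \<longleftrightarrow> odd i" by (simp add: i)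
    ultimately show ?thesis using inv[OF P[of "i + 1"]] by auto
  qed
  then show "P (i + 1) = (if even i then A else M) (P i)" .
  show "P (i - 1) = (if even i then M else A) (P i)"
    using step[of "i - 1"] inv[OF P[of "i - 1"]] by auto
qed

text \<open>The properties of a member of a class in \<open>X_space\<close> from which its line is
  built. In \<open>approx\<close> the boundary point may change with \<open>n\<close>.\<close>

locale schreier_limit =
  fixes \<Gamma> :: "('v, 'e) lgraph" and r :: 'v
  assumes det: "deterministic (\<Gamma>, r)"
    and approx: "\<exists>\<eta>. same_walks n (nb \<Gamma>) r bact \<eta>"
    and no_triple_loop: "p \<in> gverts \<Gamma> \<Longrightarrow> \<not> (nb \<Gamma> Gb p = p \<and> nb \<Gamma> Gc p = p \<and> nb \<Gamma> Gd p = p)"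
begin

text \<open>Walks one letter longer than the walk to \<open>p\<close> show which neighbours of
  \<open>p\<close> coincide. The corresponding boundary point is not all ones, as this would give
  \<open>p\<close> three loops, so \<open>bact_first_zero\<close> describes the situation at
  \<open>p\<close>.\<close>

lemma local_structure:
  assumes "p \<in> gverts \<Gamma>"
  shows "\<exists>l q. l \<noteq> La \<and> q \<noteq> p \<and> (\<forall>s. s \<noteq> Ga \<longrightarrow> nb \<Gamma> s p = (if s = loop_gen l then p else q))"
proof -
  obtain g where g: "p = foldr (nb \<Gamma>) g r" using gverts_eq_walks[OF det] assms by auto
  obtain \<eta> where \<eta>: "same_walks (Suc (length g)) (nb \<Gamma>) r bact \<eta>" using approx by blast
  define \<zeta> where "\<zeta> = foldr bact g \<eta>"
  have eq: "nb \<Gamma> s p = p \<longleftrightarrow> bact s \<zeta> = \<zeta>" "nb \<Gamma> s p = nb \<Gamma> s' p \<longleftrightarrow> bact s \<zeta> = bact s' \<zeta>" for s s'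
    using same_walksD[OF \<eta>, of "s # g" g] same_walksD[OF \<eta>, of "s # g" "s' # g"]
    by (simp_all add: g \<zeta>_def)
  obtain m where m: "\<forall>i<m. \<zeta> i" "\<not> \<zeta> m"
  proof (rule first_zero_exists)
    show "\<zeta> \<noteq> (\<lambda>_. True)" using no_triple_loop[OF assms] bact_all_ones unfolding eq by auto
  qed
  define l where "l = run_letter m"
  have l: "l \<noteq> La" by (simp add: l_def)
  obtain s0 where s0: "s0 \<noteq> Ga" "s0 \<noteq> loop_gen l" using ex_moving_gen[of l] by blast
  have flip: "\<zeta>(Suc m := \<not> \<zeta> (Suc m)) \<noteq> \<zeta>" by (metis fun_upd_same)
  show ?thesis
  proof (intro exI conjI allI impI)
    show "l \<noteq> La" by (rule l)
    show "nb \<Gamma> s0 p \<noteq> p" unfolding eq using bact_first_zero[OF m s0(1)] s0(2) flip by (simp add: l_def)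
    show "nb \<Gamma> s p = (if s = loop_gen l then p else nb \<Gamma> s0 p)" if "s \<noteq> Ga" for s
      using bact_first_zero[OF m that] bact_first_zero[OF m s0(1)] s0(2)
      by (auto simp: eq l_def)
  qed
qed

text \<open>The letter of the double edge at \<open>p\<close>, recognised by the loop label it
  leaves out; \<open>partner p\<close> will be the other end of that double edge.\<close>

definition vletter :: "'v \<Rightarrow> letter" where
  "vletter p = (SOME l. \<exists>q. l \<noteq> La \<and> q \<noteq> p \<and>
     (\<forall>s. s \<noteq> Ga \<longrightarrow> nb \<Gamma> s p = (if s = loop_gen l then p else q)))"

definition partner :: "'v \<Rightarrow> 'v" where
  "partner p = (SOME q. q \<noteq> p \<and> (\<forall>s. s \<noteq> Ga \<longrightarrow> nb \<Gamma> s p = (if s = loop_gen (vletter p) then p else q)))"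

lemma vletter_partner:
  assumes "p \<in> gverts \<Gamma>"
  shows "vletter p \<noteq> La" "partner p \<noteq> p"
    "s \<noteq> Ga \<Longrightarrow> nb \<Gamma> s p = (if s = loop_gen (vletter p) then p else partner p)"
proof -
  have l: "\<exists>q. vletter p \<noteq> La \<and> q \<noteq> p \<and>
     (\<forall>s. s \<noteq> Ga \<longrightarrow> nb \<Gamma> s p = (if s = loop_gen (vletter p) then p else q))"
    using someI_ex[OF local_structure[OF assms]] unfolding vletter_def .
  then show "vletter p \<noteq> La" by blast
  from l have "\<exists>q. q \<noteq> p \<and> (\<forall>s. s \<noteq> Ga \<longrightarrow> nb \<Gamma> s p = (if s = loop_gen (vletter p) then p else q))"
    by blast
  from someI_ex[OF this] have "partner p \<noteq> p \<and> (\<forall>s. s \<noteq> Ga \<longrightarrow> nb \<Gamma> s p = (if s = loop_gen (vletter p) then p else partner p))"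
    unfolding partner_def .
  then show "partner p \<noteq> p" "s \<noteq> Ga \<Longrightarrow> nb \<Gamma> s p = (if s = loop_gen (vletter p) then p else partner p)"
    by blast+
qed

lemma partner_in_gverts: "p \<in> gverts \<Gamma> \<Longrightarrow> partner p \<in> gverts \<Gamma>"
  using vletter_partner(3)[of p] ex_moving_gen[of "vletter p"] nb_in_gverts[OF det] by metis

text \<open>The two moving labels at \<open>p\<close> lead back from its partner, so neither is the
  loop there, and only the third label remains for it.\<close>

lemma partner_involution:
  assumes p: "p \<in> gverts \<Gamma>"
  shows "partner (partner p) = p" "vletter (partner p) = vletter p"
proof -
  define q where "q = partner p"
  have q: "q \<in> gverts \<Gamma>" using partner_in_gverts[OF p] by (simp add: q_def)
  have returns: "nb \<Gamma> s q = p" if "s \<noteq> Ga" "s \<noteq> loop_gen (vletter p)" for s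
    using vletter_partner(3)[OF p that(1)] that nb_involution[OF det p, of s] by (simp add: q_def)
  have "p \<noteq> q" using vletter_partner(2)[OF p] by (simp add: q_def)
  then have moved: "s \<noteq> loop_gen (vletter q)" if "s \<noteq> Ga" "s \<noteq> loop_gen (vletter p)" for s
    using returns[OF that] vletter_partner(3)[OF q that(1)] by auto
  then have "loop_gen (vletter q) = loop_gen (vletter p)"
    using loop_gen_neq_Ga[OF vletter_partner(1)[OF q]] by metis
  then show "vletter (partner p) = vletter p" using loop_gen_inj by (simp add: q_def)
  obtain s where s: "s \<noteq> Ga" "s \<noteq> loop_gen (vletter p)" using ex_moving_gen[of "vletter p"] by blast
  have "nb \<Gamma> s q = partner q" using vletter_partner(3)[OF q s(1)] moved[OF s] by simp
  then show "partner (partner p) = p" using returns[OF s] by (simp add: q_def)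
qed

definition line :: "int \<Rightarrow> 'v" where
  "line = zigzag_line (nb \<Gamma> Ga) partner r"

lemma line:
  "line i \<in> gverts \<Gamma>"
  "line (i + 1) = (if even i then nb \<Gamma> Ga else partner) (line i)"
  "line (i - 1) = (if even i then partner else nb \<Gamma> Ga) (line i)"
  unfolding line_def
  using zigzag_line[of r "gverts \<Gamma>" "nb \<Gamma> Ga" partner i] deterministicD(2)[OF det] nb_in_gverts[OF det]
    partner_in_gverts nb_involution[OF det] partner_involution(1) by blast+

text \<open>Letters sit on edges: the one at \<open>i\<close> belongs to the edge from
  \<open>i\<close> to \<open>i + 1\<close>, which is an \<open>a\<close>-edge for even
  \<open>i\<close> and a double edge for odd \<open>i\<close>.\<close>

definition line_word :: "int \<Rightarrow> letter" where
  "line_word i = (if even i then La else vletter (line i))"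

lemma line_word_eq_La: "line_word i = La \<longleftrightarrow> even i"
  using vletter_partner(1)[OF line(1)] by (simp add: line_word_def)

lemma vletter_line: "vletter (line i) = (if even i then line_word (i - 1) else line_word i)"
  using line(3)[of i] partner_involution(2)[OF line(1)] by (simp add: line_word_def)

lemma nb_line: "nb \<Gamma> s (line i) = line (line_nb line_word s i)"
  using vletter_partner(3)[OF line(1)[of i], of s] line(2,3)[of i] vletter_line[of i] line_word_eq_La[of i]
  by (auto simp: line_nb_def)

lemma gverts_eq_range_line: "gverts \<Gamma> = range line"
proof
  show "gverts \<Gamma> \<subseteq> range line"
  proof
    fix p assume "p \<in> gverts \<Gamma>"
    then obtain g where "p = foldr (nb \<Gamma>) g r" using gverts_eq_walks[OF det] by auto
    moreover have "foldr (nb \<Gamma>) g r \<in> range line"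
    proof (induction g)
      case Nil
      show ?case by (rule range_eqI[of _ _ 0]) (simp add: line_def zigzag_line_def)
    next
      case (Cons s g)
      then show ?case using nb_line by auto
    qed
    ultimately show "p \<in> range line" by simp
  qed
qed (use line(1) in auto)

text \<open>The part of the line around the root is retraced from one approximating boundary point,
  and \<open>pos\<close> is the Gray code of the points reached. An \<open>a\<close>-step goes up
  from even and down from odd positions, a double edge does the opposite, and the two kinds of step
  alternate; hence the direction \<sigma> of the first step persists. A letter is indexed by the
  smaller of the two positions it separates, whatever the direction, hence the minimum.\<close>

lemma window:
  fixes K :: int
  assumes K: "K \<ge> 0"
  obtains pos :: "int \<Rightarrow> nat" and q \<sigma> :: int
  where "\<sigma> = 1 \<or> \<sigma> = -1"
    and "\<And>i. \<bar>i\<bar> \<le> K \<Longrightarrow> int (pos i) = q + \<sigma> * i"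
    and "\<And>i j. \<bar>i\<bar> \<le> K \<Longrightarrow> \<bar>j\<bar> \<le> K \<Longrightarrow> line i = line j \<Longrightarrow> pos i = pos j"
    and "\<And>i. - K \<le> i \<Longrightarrow> i < K \<Longrightarrow> line_word i = toeplitz (min (pos i) (pos (i + 1)))"
proof -
  have "\<forall>i. \<exists>g. line i = foldr (nb \<Gamma>) g r" using gverts_eq_walks[OF det] line(1) by auto
  then obtain gw where gw: "\<And>i. line i = foldr (nb \<Gamma>) (gw i) r" by metis
  \<comment> \<open>The successor leaves room for one more step after each chosen walk; the range
    includes the two vertices just outside the window.\<close>
  define n where "n = Suc (Max ((\<lambda>i. length (gw i)) ` {-K-1..K+1}))"
  have n: "length (gw i) < n" if "\<bar>i\<bar> \<le> K + 1" for i
    unfolding n_def less_Suc_eq_le using that by (intro Max_ge) (auto intro!: image_eqI[of _ _ i])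
  obtain \<eta> where \<eta>: "same_walks n (nb \<Gamma>) r bact \<eta>" using approx by blast
  define Q where "Q i = foldr bact (gw i) \<eta>" for i
  have Q_eq: "line i = line j \<longleftrightarrow> Q i = Q j" if "\<bar>i\<bar> \<le> K + 1" "\<bar>j\<bar> \<le> K + 1" for i j
    unfolding gw Q_def using n[OF that(1)] n[OF that(2)] by (intro same_walksD[OF \<eta>]) auto
  have Q_act: "bact s (Q i) = Q j \<longleftrightarrow> nb \<Gamma> s (line i) = line j" if "\<bar>i\<bar> \<le> K" "\<bar>j\<bar> \<le> K + 1" for s i j
    using same_walksD[OF \<eta>, of "s # gw i" "gw j"] n[of i] n[OF that(2)] that(1) by (simp add: gw Q_def)
  have "\<exists>m. (\<forall>k<m. Q i k) \<and> \<not> Q i m" if i: "\<bar>i\<bar> \<le> K" for i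
  proof -
    obtain s where "s \<noteq> Ga" "s \<noteq> loop_gen (vletter (line i))"
      using ex_moving_gen[of "vletter (line i)"] by blast
    then have "nb \<Gamma> s (line i) \<noteq> line i" using vletter_partner(2,3)[OF line(1)[of i]] by simp
    then have "Q i \<noteq> (\<lambda>_. True)" using Q_act[of i i s] i \<open>s \<noteq> Ga\<close> bact_all_ones by auto
    then show ?thesis using first_zero_exists by metis
  qed
  then obtain z where z: "\<And>i. \<bar>i\<bar> \<le> K \<Longrightarrow> (\<forall>k<z i. Q i k) \<and> \<not> Q i (z i)" by metis
  \<comment> \<open>The two successors give the bound required by \<open>gray_flip\<close> at every
    vertex of the window, and the positive level required by \<open>gray_bact_Ga\<close>.\<close>
  define N where "N = Suc (Suc (Max (z ` {-K..K})))"
  have N: "z i + 2 \<le> N" if "\<bar>i\<bar> \<le> K" for i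
  proof -
    have "z i \<le> Max (z ` {-K..K})" using that by (intro Max_ge) (auto intro!: image_eqI[of _ _ i])
    then show ?thesis by (simp add: N_def)
  qed
  define pos where "pos i = gray N (Q i)" for i
  have A_step: "int (pos j) = int (pos i) + (if even (pos i) then 1 else -1)"
    if "\<bar>i\<bar> \<le> K" "\<bar>j\<bar> \<le> K + 1" "line j = nb \<Gamma> Ga (line i)" for i j
  proof -
    have Qj: "Q j = bact Ga (Q i)" using Q_act[OF that(1,2), of Ga] that(3) by simp
    show ?thesis unfolding pos_def N_def Qj by (rule gray_bact_Ga)
  qed
  have M_step: "odd (pos i) \<and> pos j = Suc (pos i) \<and> toeplitz (pos i) = vletter (line i) \<or>
      even (pos i) \<and> pos i = Suc (pos j) \<and> toeplitz (pos j) = vletter (line i)"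
    if "\<bar>i\<bar> \<le> K" "\<bar>j\<bar> \<le> K + 1" "line j = partner (line i)" for i j
  proof -
    note zi = z[OF that(1)]
    have fz: "s \<noteq> Ga \<Longrightarrow> bact s (Q i) = (if s = loop_gen (run_letter (z i)) then Q i
        else (Q i)(Suc (z i) := \<not> Q i (Suc (z i))))" for s
      using bact_first_zero[of "z i" "Q i" s] zi by blast
    have flip: "(Q i)(Suc (z i) := \<not> Q i (Suc (z i))) \<noteq> Q i" by (metis fun_upd_same)
    have "s = loop_gen (run_letter (z i)) \<longleftrightarrow> s = loop_gen (vletter (line i))" if "s \<noteq> Ga" for s
      using Q_act[of i i s] \<open>\<bar>i\<bar> \<le> K\<close> fz[OF that] flip vletter_partner(2,3)[OF line(1)[of i]] that
      by (auto split: if_splits)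
    then have "loop_gen (run_letter (z i)) = loop_gen (vletter (line i))"
      using loop_gen_neq_Ga[OF run_letter_neq_La] by metis
    then have letter: "run_letter (z i) = vletter (line i)" by (rule loop_gen_inj)
    obtain s where s: "s \<noteq> Ga" "s \<noteq> loop_gen (vletter (line i))"
      using ex_moving_gen[of "vletter (line i)"] by blast
    have "bact s (Q i) = Q j"
      using Q_act[OF that(1,2), of s] that(3) vletter_partner(3)[OF line(1)[of i] s(1)] s(2) by simp
    then have "Q j = (Q i)(Suc (z i) := \<not> Q i (Suc (z i)))" using fz[OF s(1)] s(2) letter by simp
    then show ?thesis
      using gray_flip[of "z i" "Q i" N] zi N[OF that(1)] letter unfolding pos_def by simp
  qed
  \<comment> \<open>The step from 0 to 1 is an \<open>a\<close>-step, which goes up exactly from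
    even positions.\<close>
  define \<sigma> :: int where "\<sigma> = (if even (pos 0) then 1 else -1)"
  have up: "int (pos (i + 1)) = int (pos i) + \<sigma>"
    if "- K \<le> i" "i \<le> K" "even (pos i) \<longleftrightarrow> (even (pos 0) \<longleftrightarrow> even i)" for i
  proof -
    have "\<bar>i\<bar> \<le> K" "\<bar>i + 1\<bar> \<le> K + 1" using that by auto
    note steps = A_step[OF this] M_step[OF this]
    show ?thesis
      using steps line(2)[of i] that(3) by (cases "even i"; cases "even (pos 0)") (simp_all add: \<sigma>_def)
  qed
  have down: "int (pos (i - 1)) = int (pos i) - \<sigma>"
    if "- K \<le> i" "i \<le> K" "even (pos i) \<longleftrightarrow> (even (pos 0) \<longleftrightarrow> even i)" for i
  proof -
    have "\<bar>i\<bar> \<le> K" "\<bar>i - 1\<bar> \<le> K + 1" using that by auto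
    note steps = A_step[OF this] M_step[OF this]
    show ?thesis
      using steps line(3)[of i] that(3) by (cases "even i"; cases "even (pos 0)") (simp_all add: \<sigma>_def)
  qed
  have parity: "even (pos i) \<longleftrightarrow> (even (pos 0) \<longleftrightarrow> even i)" if "int (pos i) = int (pos 0) + \<sigma> * i" for i
  proof -
    have "even (int (pos i)) \<longleftrightarrow> even (int (pos 0) + \<sigma> * i)" using that by simp
    then show ?thesis by (auto simp: \<sigma>_def)
  qed
  have pos: "int (pos i) = int (pos 0) + \<sigma> * i" if "\<bar>i\<bar> \<le> K" for i
    using that
  proof (induction i rule: int_induct[where k = 0])
    case base
    show ?case by simp
  next
    case (step1 i)
    then have IH: "int (pos i) = int (pos 0) + \<sigma> * i" by simp
    then show ?case using up[of i] parity[OF IH] step1 by (simp add: algebra_simps)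
  next
    case (step2 i)
    then have IH: "int (pos i) = int (pos 0) + \<sigma> * i" by simp
    then show ?case using down[of i] parity[OF IH] step2 by (simp add: algebra_simps)
  qed
  have word: "line_word i = toeplitz (min (pos i) (pos (i + 1)))" if i: "- K \<le> i" "i < K" for i
  proof -
    have i': "\<bar>i\<bar> \<le> K" using i by auto
    note par = parity[OF pos[OF i']]
    show ?thesis
    proof (cases "even i")
      case True
      then have step: "int (pos (i + 1)) = int (pos i) + (if even (pos i) then 1 else -1)"
        using A_step[of i "i + 1"] i' i line(2)[of i] by simp
      have "even (min (pos i) (pos (i + 1)))"
      proof (cases "even (pos i)")
        case even: True
        then show ?thesis using step by (simp add: min_def)
      next
        case odd: False
        then have "pos i = Suc (pos (i + 1))" using step by simp
        then show ?thesis using odd by simp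
      qed
      then show ?thesis using True by (simp add: line_word_def)
    next
      case False
      then show ?thesis
        using M_step[of i "i + 1"] i' i line(2)[of i] by (auto simp: line_word_def min_def)
    qed
  qed
  show thesis
  proof (rule that[of \<sigma> pos "int (pos 0)"])
    show "\<sigma> = 1 \<or> \<sigma> = -1" by (simp add: \<sigma>_def)
    show "pos i = pos j" if "\<bar>i\<bar> \<le> K" "\<bar>j\<bar> \<le> K" "line i = line j" for i j
      using Q_eq[of i j] that by (simp add: pos_def)
    show "int (pos i) = int (pos 0) + \<sigma> * i" if "\<bar>i\<bar> \<le> K" for i by (rule pos[OF that])
    show "line_word i = toeplitz (min (pos i) (pos (i + 1)))" if "- K \<le> i" "i < K" for i
      by (rule word[OF that])
  qed
qed

text \<open>Equal vertices in a window have equal positions, and positions are strictly monotone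
  along it, so the line neither closes up nor folds back.\<close>

lemma bij_line: "bij_betw line UNIV (gverts \<Gamma>)"
proof -
  have "inj line"
  proof (rule injI)
    fix i j assume eq: "line i = line j"
    define K where "K = max \<bar>i\<bar> \<bar>j\<bar>"
    have "K \<ge> 0" "\<bar>i\<bar> \<le> K" "\<bar>j\<bar> \<le> K" by (auto simp: K_def)
    then obtain pos :: "int \<Rightarrow> nat" and q \<sigma> :: int
      where "\<sigma> = 1 \<or> \<sigma> = -1" "int (pos i) = q + \<sigma> * i" "int (pos j) = q + \<sigma> * j" "pos i = pos j"
      using window[of K] eq by metis
    then show "i = j" by auto
  qed
  then show ?thesis by (simp add: bij_betw_def gverts_eq_range_line)
qed

lemma line_word_in_Omega_tau: "line_word \<in> Omega_tau"
  unfolding Omega_tau_def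
proof (intro CollectI allI)
  fix i j :: int
  show "map line_word [i..j] \<in> Sub_tau"
  proof (cases "i \<le> j")
    case False
    then show ?thesis using toeplitz_window_in_Sub_tau[of 0 0] by simp
  next
    case True
    \<comment> \<open>The letter at \<open>j\<close> lies between the vertices \<open>j\<close> and
      \<open>j + 1\<close>, so the window has to reach \<open>j + 1\<close>.\<close>
    define K where "K = max \<bar>i\<bar> \<bar>j + 1\<bar>"
    have "K \<ge> 0" by (simp add: K_def)
    then obtain pos :: "int \<Rightarrow> nat" and q \<sigma> :: int
      where \<sigma>: "\<sigma> = 1 \<or> \<sigma> = -1"
        and pos: "\<And>k. \<bar>k\<bar> \<le> K \<Longrightarrow> int (pos k) = q + \<sigma> * k"
        and word: "\<And>k. - K \<le> k \<Longrightarrow> k < K \<Longrightarrow> line_word k = toeplitz (min (pos k) (pos (k + 1)))"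
      by (rule window[of K]) blast
    have ends: "int (pos i) = q + \<sigma> * i" "int (pos (j + 1)) = q + \<sigma> * (j + 1)"
      using pos[of i] pos[of "j + 1"] by (auto simp: K_def)
    have step: "line_word (i + int k) = toeplitz (min (pos (i + int k)) (pos (i + int k + 1)))"
      "int (pos (i + int k)) = q + \<sigma> * (i + int k)"
      "int (pos (i + int k + 1)) = q + \<sigma> * (i + int k + 1)"
      if "k < nat (j - i + 1)" for k
      using that pos[of "i + int k"] pos[of "i + int k + 1"] word[of "i + int k"] by (auto simp: K_def)
    from \<sigma> show ?thesis
    proof
      assume 1: "\<sigma> = 1"
      have "map line_word [i..j] = map toeplitz [pos i..<pos (j + 1)]"
      proof (rule nth_equalityI)
        show len: "length (map line_word [i..j]) = length (map toeplitz [pos i..<pos (j + 1)])"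
          using ends 1 by simp
        fix k assume "k < length (map line_word [i..j])"
        then have k: "k < nat (j - i + 1)" "k < pos (j + 1) - pos i" using len by simp_all
        have "min (pos (i + int k)) (pos (i + int k + 1)) = pos i + k"
          using step(2,3)[OF k(1)] ends 1 by simp
        then show "map line_word [i..j] ! k = map toeplitz [pos i..<pos (j + 1)] ! k"
          using k step(1)[OF k(1)] by (simp add: nth_upto)
      qed
      then show ?thesis using toeplitz_window_in_Sub_tau by simp
    next
      assume 1: "\<sigma> = -1"
      have "map line_word [i..j] = rev (map toeplitz [pos (j + 1)..<pos i])"
      proof (rule nth_equalityI)
        show len: "length (map line_word [i..j]) = length (rev (map toeplitz [pos (j + 1)..<pos i]))"
          using ends 1 by simp
        fix k assume "k < length (map line_word [i..j])"
        then have k: "k < nat (j - i + 1)" "k < pos i - pos (j + 1)" using len by simp_all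
        \<comment> \<open>Read backwards, the letter at offset \<open>k\<close> lies between
          \<open>pos i - k\<close> and \<open>pos i - Suc k\<close>, and the smaller one indexes
          it.\<close>
        have "min (pos (i + int k)) (pos (i + int k + 1)) = pos (j + 1) + (pos i - pos (j + 1) - Suc k)"
          using step(2,3)[OF k(1)] ends 1 k by simp
        then show "map line_word [i..j] ! k = rev (map toeplitz [pos (j + 1)..<pos i]) ! k"
          using k step(1)[OF k(1)] by (simp add: nth_upto rev_nth)
      qed
      then show ?thesis using rev_in_Sub_tau[OF toeplitz_window_in_Sub_tau] by simp
    qed
  qed
qed

end

section \<open>From the labelled line to the operator\<close>

lemma H_op_eq_laplacian:
  assumes det: "deterministic (\<Gamma>, r)" and P: "bij_betw P UNIV (gverts \<Gamma>)"
    and nb: "\<And>s n. nb \<Gamma> s (P n) = P (line_nb \<omega> s n)"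
    and alt: "\<And>n. \<omega> n = La \<longleftrightarrow> even n"
  shows "unitarily_equivalent UNIV (H_op t u v w \<omega>) (gverts \<Gamma>) (laplacian t u v w \<Gamma>)"
proof (rule unitarily_equivalent_bij[OF P])
  fix \<psi> n
  have "P n \<in> gverts \<Gamma>" using P by (auto simp: bij_betw_def)
  note lap = laplacian_nb[OF det this, of t u v w \<psi>, unfolded nb]
  show "laplacian t u v w \<Gamma> \<psi> (P n) = H_op t u v w \<omega> (\<psi> \<circ> P) n"
  \<comment> \<open>On one side of \<open>n\<close> is the \<open>a\<close>-edge, on the other a
    double edge. The loop weight is the diagonal coefficient, and \<open>D\<close> minus the loop
    weight is the total weight of the double edge.\<close>
  proof (cases "even n")
    case True
    then have "\<omega> n = La" "\<omega> (n - 1) \<noteq> La" using alt by auto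
    then show ?thesis
      by (cases "\<omega> (n - 1)")
        (simp_all add: lap line_nb_def H_op_def f_coeff_def g_coeff_def shift_def algebra_simps)
  next
    case False
    then have "\<omega> n \<noteq> La" "\<omega> (n - 1) = La" using alt by auto
    then show ?thesis
      by (cases "\<omega> n")
        (simp_all add: lap line_nb_def H_op_def f_coeff_def g_coeff_def shift_def algebra_simps)
  qed
qed (simp add: laplacian_def)

theorem proposition4p1:
  fixes t u v w :: real
    and x :: "(boundary, schreier_edge) rooted_lgraph set"
  assumes "x \<in> X_space"
  shows "\<exists>\<omega>\<in>Omega_tau. \<forall>(\<Gamma>, r)\<in>x.
           unitarily_equivalent UNIV (H_op t u v w \<omega>) (gverts \<Gamma>) (laplacian t u v w \<Gamma>)"
proof -
  have xc: "x \<in> schreier_closure" using assms by (simp add: X_space_def)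
  note xD = schreier_closureD[OF xc]
  have "x \<noteq> {}" using in_quotient_imp_non_empty[OF equiv_rooted_iso_rel] xD(1)
    by (simp add: graph_space_def)
  then obtain \<Gamma> r where R: "(\<Gamma>, r) \<in> x" by auto
  interpret schreier_limit \<Gamma> r
    by unfold_locales (use xD(2,3)[OF R] X_space_no_triple_loop[OF assms R] in auto)
  \<comment> \<open>The word of one representative serves for the whole class, since an isomorphism
    maps the line onto a line with the same labels.\<close>
  have "unitarily_equivalent UNIV (H_op t u v w line_word) (gverts \<Gamma>') (laplacian t u v w \<Gamma>')"
    if R': "(\<Gamma>', r') \<in> x" for \<Gamma>' r'
  proof -
    have "((\<Gamma>, r), (\<Gamma>', r')) \<in> rooted_iso_rel"
      using graph_space_class(2)[OF xD(1) R] R' by auto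
    then have "rooted_iso (\<Gamma>, r) (\<Gamma>', r')" by (simp add: rooted_iso_rel_def)
    then obtain f where f: "bij_betw f (gverts \<Gamma>) (gverts \<Gamma>')"
      "\<And>p s. p \<in> gverts \<Gamma> \<Longrightarrow> nb \<Gamma>' s (f p) = f (nb \<Gamma> s p)"
      using nb_iso[OF xD(2)[OF R] xD(2)[OF R']] by metis
    show ?thesis
      using bij_betw_trans[OF bij_line f(1)]
      by (rule H_op_eq_laplacian[OF xD(2)[OF R']]) (simp_all add: f(2) line(1) nb_line line_word_eq_La)
  qed
  then show ?thesis using line_word_in_Omega_tau by blast
qed

end
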